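(* Let $n\ge 3$, let $A_1,\dots,A_n$ be qubit systems with standard bases $\{|0\rangle,|1\rangle\}$, let $A_1',\dots,A_n'$ be finite-dimensional quantum systems of arbitrary dimensions, and let $\rho_n$ be a density operator on $A_1\cdots A_nA_1'\cdots A_n'$. Then $\rho_n$ is a quantum state for the $n$-party perfectly secure secret sharing (PSSS) consisting of one dealer and $n-1$ players if and only if there exist a density operator $\rho_{A_1'\cdots A_n'}$ on $A_1'\cdots A_n'$ and unitary operators $U_I$ on $A_1'\cdots A_n'$, one for each $I\in\{0,1\}^n$ of even parity, such that $$\rho_n=\frac{1}{2^{n-1}}\sum_{\substack{I,J\in\{0,1\}^n\\ I,J\ \text{of even parity}}}|I\rangle\langle J|_{A_1\cdots A_n}\otimes U_I\,\rho_{A_1'\cdots A_n'}\,U_J^{\dagger}.$$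
   Context: A string $I\in\{0,1\}^n$ has even parity if it contains an even number of ones. Party $m$ holds the systems $A_mA_m'$ ($m=1,\dots,n$); one party is the dealer and the others are players. An eavesdropper Eve is assumed to hold the purifying system $E$: let $|\Psi\rangle$ be a purification of $\rho_n$ on $A_1\cdots A_nA_1'\cdots A_n'E$. The participants measure $A_1,\dots,A_n$ in the standard basis. Write $$|\Psi\rangle=\sum_{I\in\{0,1\}^n}\sqrt{p_I}\,|I\rangle_{A_1\cdots A_n}|\Psi_I\rangle_{A_1'\cdots A_n'E}$$ with unit vectors $|\Psi_I\rangle$, so $p_I$ is the probability of the joint outcome $I$, and $\rho_I^E=\mathrm{tr}_{A_1'\cdots A_n'}(|\Psi_I\rangle\langle\Psi_I|)$ is Eve's state after outcome $I$. The state $\rho_n$ is a *quantum state for the $n$-party PSSS* if both of the following hold: (i) $p_I=1/2^{n-1}$ for every $I$ of even parity, and $p_I=0$ for every $I$ of odd parity; (ii) the states $\rho_I^E$, for $I$ of even parity, are all equal. (These conditions do not depend on the choice of purification.) *)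

theory Defs
  imports "Jordan_Normal_Form.Schur_Decomposition"
begin

text \<open>
  Operators on \<open>\<complex>\<^sup>D\<close> are \<open>D \<times> D\<close> complex matrices. A composite system carries the Kronecker
  (lexicographic) product basis, with the basis vector \<open>|i\<rangle>|j\<rangle>\<close> of \<open>\<complex>\<^sup>a \<otimes> \<complex>\<^sup>b\<close>
  at index \<open>i * b + j\<close>.
\<close>

definition tensor_vec :: "complex vec \<Rightarrow> complex vec \<Rightarrow> complex vec" where
  "tensor_vec u v = vec (dim_vec u * dim_vec v)
     (\<lambda>i. u $ (i div dim_vec v) * v $ (i mod dim_vec v))"

definition tensor_mat :: "complex mat \<Rightarrow> complex mat \<Rightarrow> complex mat" where
  "tensor_mat A B = mat (dim_row A * dim_row B) (dim_col A * dim_col B)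
     (\<lambda>(i, j). A $$ (i div dim_row B, j div dim_col B) * B $$ (i mod dim_row B, j mod dim_col B))"

definition ketbra :: "complex vec \<Rightarrow> complex vec \<Rightarrow> complex mat" where
  "ketbra u v = mat (dim_vec u) (dim_vec v) (\<lambda>(i, j). u $ i * cnj (v $ j))"

definition trace_mat :: "complex mat \<Rightarrow> complex" where
  "trace_mat A = (\<Sum>i<dim_row A. A $$ (i, i))"

text \<open>Partial traces of an operator on \<open>\<complex>\<^sup>a \<otimes> \<complex>\<^sup>b\<close> over the second and the first factor.\<close>

definition ptrace_snd :: "nat \<Rightarrow> nat \<Rightarrow> complex mat \<Rightarrow> complex mat" where
  "ptrace_snd a b M = mat a a (\<lambda>(i, j). \<Sum>k<b. M $$ (i * b + k, j * b + k))"

definition ptrace_fst :: "nat \<Rightarrow> nat \<Rightarrow> complex mat \<Rightarrow> complex mat" where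
  "ptrace_fst a b M = mat b b (\<lambda>(i, j). \<Sum>k<a. M $$ (k * b + i, k * b + j))"

definition finsum_mat :: "nat \<Rightarrow> nat \<Rightarrow> ('i \<Rightarrow> complex mat) \<Rightarrow> 'i set \<Rightarrow> complex mat" where
  "finsum_mat nr nc = finsum (module_mat TYPE(complex) nr nc)"

text \<open>The order on \<open>complex\<close> is that of \<open>HOL-Library.Complex_Order\<close>: \<open>0 \<le> z\<close> says that
  \<open>z\<close> is real and nonnegative.\<close>

definition density_operator :: "nat \<Rightarrow> complex mat \<Rightarrow> bool" where
  "density_operator D \<rho> \<longleftrightarrow> \<rho> \<in> carrier_mat D D \<and>
     (\<forall>v \<in> carrier_vec D. 0 \<le> (\<rho> *\<^sub>v v) \<bullet>c v) \<and> trace_mat \<rho> = 1"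

definition unitary_op :: "nat \<Rightarrow> complex mat \<Rightarrow> bool" where
  "unitary_op D U \<longleftrightarrow> U \<in> carrier_mat D D \<and>
     U * mat_adjoint U = 1\<^sub>m D \<and> mat_adjoint U * U = 1\<^sub>m D"

definition purification :: "nat \<Rightarrow> nat \<Rightarrow> complex mat \<Rightarrow> complex vec \<Rightarrow> bool" where
  "purification D e \<rho> \<Psi> \<longleftrightarrow> \<Psi> \<in> carrier_vec (D * e) \<and> ptrace_snd D e (ketbra \<Psi> \<Psi>) = \<rho>"

text \<open>Bit strings are Boolean lists, \<open>True\<close> standing for 1.\<close>

definition bit_strings :: "nat \<Rightarrow> bool list set" where
  "bit_strings n = {I. length I = n}"

definition even_strings :: "nat \<Rightarrow> bool list set" where
  "even_strings n = {I \<in> bit_strings n. even (count_list I True)}"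

primrec ket :: "bool list \<Rightarrow> complex vec" where
  "ket [] = unit_vec 1 0"
| "ket (b # I) = tensor_vec (unit_vec 2 (of_bool b)) (ket I)"

text \<open>
  The joint system is ordered as \<open>A\<^sub>1 \<dots> A\<^sub>n A'\<^sub>1 \<dots> A'\<^sub>n E\<close>, where \<open>A'\<^sub>m\<close> has
  dimension \<open>d m\<close> and \<open>E\<close> has dimension \<open>e\<close>.
\<close>

definition aux_dim :: "nat \<Rightarrow> (nat \<Rightarrow> nat) \<Rightarrow> nat" where
  "aux_dim n d = (\<Prod>m=1..n. d m)"

text \<open>
  \<open>outcome_decomposition n D e \<Psi> p \<Phi>\<close> says that
  \<open>\<Psi> = \<Sum>\<^sub>I \<surd>(p I) |I\<rangle> \<otimes> \<Phi> I\<close> with unit vectors \<open>\<Phi> I\<close> of \<open>A'\<^sub>1 \<dots> A'\<^sub>n E\<close>, where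
  \<open>A'\<^sub>1 \<dots> A'\<^sub>n\<close> has dimension \<open>D\<close>. If \<open>p I = 0\<close> then \<open>\<Phi> I\<close> is an arbitrary unit vector.
\<close>

definition outcome_decomposition ::
  "nat \<Rightarrow> nat \<Rightarrow> nat \<Rightarrow> complex vec \<Rightarrow> (bool list \<Rightarrow> real) \<Rightarrow> (bool list \<Rightarrow> complex vec) \<Rightarrow> bool" where
  "outcome_decomposition n D e \<Psi> p \<Phi> \<longleftrightarrow>
     (\<forall>I \<in> bit_strings n. 0 \<le> p I \<and> \<Phi> I \<in> carrier_vec (D * e) \<and> \<Phi> I \<bullet>c \<Phi> I = 1) \<and>
     \<Psi> = finsum_vec TYPE(complex) (2 ^ n * (D * e))
           (\<lambda>I. complex_of_real (sqrt (p I)) \<cdot>\<^sub>v tensor_vec (ket I) (\<Phi> I)) (bit_strings n)"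

definition eve_state :: "nat \<Rightarrow> nat \<Rightarrow> complex vec \<Rightarrow> complex mat" where
  "eve_state D e \<phi> = ptrace_fst D e (ketbra \<phi> \<phi>)"

text \<open>
  The conditions are demanded of every purification with a finite-dimensional \<open>E\<close>; they do not
  depend on its choice, nor on the choice of the \<open>\<Phi> I\<close> with \<open>p I = 0\<close>. The choice of the
  dealer among the parties plays no role in them.
\<close>

definition psss_state :: "nat \<Rightarrow> (nat \<Rightarrow> nat) \<Rightarrow> complex mat \<Rightarrow> bool" where
  "psss_state n d \<rho> \<longleftrightarrow>
     (\<forall>e \<Psi> p \<Phi>.
        purification (2 ^ n * aux_dim n d) e \<rho> \<Psi> \<longrightarrow>
        outcome_decomposition n (aux_dim n d) e \<Psi> p \<Phi> \<longrightarrow>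
        (\<forall>I \<in> even_strings n. p I = 1 / 2 ^ (n - 1)) \<and>
        (\<forall>I \<in> bit_strings n - even_strings n. p I = 0) \<and>
        (\<forall>I \<in> even_strings n. \<forall>J \<in> even_strings n.
           eve_state (aux_dim n d) e (\<Phi> I) = eve_state (aux_dim n d) e (\<Phi> J)))"

end

theory Submission
  imports Defs
begin

text \<open>
  Read the vector \<open>\<Phi> I\<close> as a matrix \<open>F I\<close> from Eve's system to \<open>A'\<^sub>1 \<dots> A'\<^sub>n\<close>. Then Eve's state is the
  transpose of \<open>(F I)\<^sup>* F I\<close>, and the \<open>(I, J)\<close> block of \<open>\<rho>\<close> is \<open>\<surd>(p I p J) F I (F J)\<^sup>*\<close>.

  If Eve's states agree, the matrices \<open>F I\<close> have the same Gram matrix, hence \<open>F I = U I F Z\<close> with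
  \<open>U I\<close> unitary and \<open>Z = 0\<dots>0\<close>, and \<open>\<sigma> = F Z (F Z)\<^sup>*\<close> gives the claimed form.
  Conversely, if \<open>F I (F J)\<^sup>* = U I \<sigma> (U J)\<^sup>*\<close>, the matrices \<open>G I = (U I)\<^sup>* F I\<close> satisfy
  \<open>G I (G J)\<^sup>* = \<sigma>\<close> for all \<open>I\<close> and \<open>J\<close>. Thus \<open>(G I - G J) (G I - G J)\<^sup>* = 0\<close>, so \<open>G I\<close> does not
  depend on \<open>I\<close>, and neither does \<open>(F I)\<^sup>* F I = (G I)\<^sup>* G I\<close>.
\<close>

section \<open>Adjoints and unitary operators\<close>

lemma mat_adjoint_index [simp]:
  assumes "i < dim_col A" "j < dim_row A"
  shows "mat_adjoint A $$ (i, j) = conjugate (A $$ (j, i))"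
  using assms unfolding mat_adjoint_def by (simp add: mat_of_rows_index)

lemma mat_adjoint_dim [simp]:
  "dim_row (mat_adjoint A) = dim_col A" "dim_col (mat_adjoint A) = dim_row A"
  unfolding mat_adjoint_def by auto

lemma mat_adjoint_carrier [simp]:
  "mat_adjoint A \<in> carrier_mat m n \<longleftrightarrow> A \<in> carrier_mat n m"
  unfolding carrier_mat_def mem_Collect_eq mat_adjoint_dim by (rule conj_commute)

lemma mat_adjoint_mat_adjoint [simp]: "mat_adjoint (mat_adjoint A) = A"
  by (rule eq_matI) auto

lemma mat_adjoint_one [simp]: "mat_adjoint (1\<^sub>m n) = (1\<^sub>m n :: complex mat)"
  by (rule eq_matI) auto

lemma mat_adjoint_zero [simp]: "mat_adjoint (0\<^sub>m m n) = (0\<^sub>m n m :: complex mat)"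
  by (rule eq_matI) auto

lemma mat_adjoint_mult:
  assumes "A \<in> carrier_mat m n" "B \<in> carrier_mat n p"
  shows "mat_adjoint (A * B) = mat_adjoint B * mat_adjoint A"
  using assms
  by (intro eq_matI)
    (auto simp: scalar_prod_def sum_conjugate conjugate_dist_mul ac_simps intro!: sum.cong)

lemma mat_adjoint_add:
  assumes "A \<in> carrier_mat m n" "B \<in> carrier_mat m n"
  shows "mat_adjoint (A + B) = mat_adjoint A + mat_adjoint B"
  using assms by (intro eq_matI) (auto simp: conjugate_dist_add)

lemma mat_adjoint_minus:
  fixes A B :: "complex mat"
  assumes "A \<in> carrier_mat m n" "B \<in> carrier_mat m n"
  shows "mat_adjoint (A - B) = mat_adjoint A - mat_adjoint B"
  using assms by (intro eq_matI) auto

lemma mat_adjoint_smult: "mat_adjoint (k \<cdot>\<^sub>m A) = conjugate k \<cdot>\<^sub>m mat_adjoint A"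
  by (intro eq_matI) (auto simp: conjugate_dist_mul)

lemma smult_mult_smult_mat:
  fixes A B :: "complex mat"
  assumes "A \<in> carrier_mat m n" "B \<in> carrier_mat n p"
  shows "(c \<cdot>\<^sub>m A) * (k \<cdot>\<^sub>m B) = (c * k) \<cdot>\<^sub>m (A * B)"
proof -
  have "(c \<cdot>\<^sub>m A) * (k \<cdot>\<^sub>m B) = c \<cdot>\<^sub>m (k \<cdot>\<^sub>m (A * B))"
    using assms mult_smult_assoc_mat[of A m n "k \<cdot>\<^sub>m B" p c] mult_smult_distrib[of A m n B p k] by simp
  then show ?thesis by (intro eq_matI) auto
qed

text \<open>The indices appear swapped on the right because \<open>\<bullet>c\<close> conjugates its
  second argument. This is the link between Gram matrices and inner products of columns.\<close>

lemma adjoint_times_self_index: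
  assumes "A \<in> carrier_mat m n" "i < n" "j < n"
  shows "(mat_adjoint A * A) $$ (i, j) = col A j \<bullet>c col A i"
  using assms by (auto simp: scalar_prod_def ac_simps intro!: sum.cong)

text \<open>Both sides are the same double sum, taken in the two possible orders.\<close>

lemma mult_mat_vec_cscalar_prod:
  fixes A :: "complex mat"
  assumes "A \<in> carrier_mat m n" "x \<in> carrier_vec n" "y \<in> carrier_vec m"
  shows "(A *\<^sub>v x) \<bullet>c y = x \<bullet>c (mat_adjoint A *\<^sub>v y)"
proof -
  have "(A *\<^sub>v x) \<bullet>c y = (\<Sum>i<m. \<Sum>j<n. A $$ (i, j) * x $ j * cnj (y $ i))"
    using assms by (auto simp: scalar_prod_def sum_distrib_right atLeast0LessThan intro!: sum.cong)
  also have "\<dots> = (\<Sum>j<n. \<Sum>i<m. A $$ (i, j) * x $ j * cnj (y $ i))"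
    by (rule sum.swap)
  also have "\<dots> = x \<bullet>c (mat_adjoint A *\<^sub>v y)"
    using assms by (auto simp: scalar_prod_def sum_distrib_left atLeast0LessThan ac_simps intro!: sum.cong)
  finally show ?thesis .
qed

lemma unitary_op_carrier: "unitary_op D U \<Longrightarrow> U \<in> carrier_mat D D"
  by (simp add: unitary_op_def)

lemma unitary_op_one: "unitary_op D (1\<^sub>m D)"
  by (simp add: unitary_op_def)

lemma unitary_op_adjoint: "unitary_op D U \<Longrightarrow> unitary_op D (mat_adjoint U)"
  by (simp add: unitary_op_def)

lemma unitary_op_mult:
  assumes "unitary_op D U" "unitary_op D V"
  shows "unitary_op D (U * V)"
proof -
  \<comment> \<open>Stated for four matrices so that one cancellation of the inner pair serves both
    identities in \<open>unitary_op\<close>.\<close>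
  have *: "(A * B) * (C * E) = 1\<^sub>m D"
    if "A \<in> carrier_mat D D" "B \<in> carrier_mat D D" "C \<in> carrier_mat D D" "E \<in> carrier_mat D D"
      "B * C = 1\<^sub>m D" "A * E = 1\<^sub>m D" for A B C E :: "complex mat"
  proof -
    have "(A * B) * (C * E) = A * (B * (C * E))" using that by (simp add: assoc_mult_mat[of _ D D _ D _ D])
    also have "B * (C * E) = (B * C) * E" using that by (intro assoc_mult_mat[symmetric]) auto
    finally show ?thesis using that by simp
  qed
  show ?thesis
    using assms unfolding unitary_op_def
    by (auto simp: mat_adjoint_mult[of U D D V D] intro!: *)
qed

lemma unitary_op_cscalar_prod:
  assumes U: "unitary_op D U" and x: "x \<in> carrier_vec D" and y: "y \<in> carrier_vec D"
  shows "(U *\<^sub>v x) \<bullet>c (U *\<^sub>v y) = x \<bullet>c y"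
proof -
  have c: "U \<in> carrier_mat D D" "mat_adjoint U \<in> carrier_mat D D"
    using U by (auto simp: unitary_op_def)
  have "(U *\<^sub>v x) \<bullet>c (U *\<^sub>v y) = x \<bullet>c (mat_adjoint U *\<^sub>v (U *\<^sub>v y))"
    using c x y by (intro mult_mat_vec_cscalar_prod[of _ D D]) auto
  also have "mat_adjoint U *\<^sub>v (U *\<^sub>v y) = (mat_adjoint U * U) *\<^sub>v y"
    using assoc_mult_mat_vec[OF c(2,1) y] by simp
  finally show ?thesis using U y by (simp add: unitary_op_def)
qed

section \<open>Rank-one operators and reflections\<close>

lemma ketbra_carrier [simp]:
  "u \<in> carrier_vec m \<Longrightarrow> v \<in> carrier_vec n \<Longrightarrow> ketbra u v \<in> carrier_mat m n"
  by (auto simp: ketbra_def)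

lemma mat_adjoint_ketbra: "mat_adjoint (ketbra u v) = ketbra v u"
  by (rule eq_matI) (auto simp: ketbra_def)

lemma ketbra_mult_vec:
  assumes "dim_vec x = dim_vec v"
  shows "ketbra u v *\<^sub>v x = (x \<bullet>c v) \<cdot>\<^sub>v u"
  using assms
  by (intro eq_vecI)
    (auto simp: ketbra_def scalar_prod_def sum_distrib_left sum_distrib_right ac_simps intro!: sum.cong)

lemma ketbra_mult_ketbra:
  assumes "dim_vec v = dim_vec w"
  shows "ketbra u v * ketbra w z = (w \<bullet>c v) \<cdot>\<^sub>m ketbra u z"
  using assms
  by (intro eq_matI)
    (auto simp: ketbra_def scalar_prod_def sum_distrib_left sum_distrib_right ac_simps intro!: sum.cong)

text \<open>
  The complex Householder reflection \<open>1 + v v\<^sup>* / s\<close> with \<open>v = a - b\<close> and \<open>s = v\<^sup>* b\<close>; it is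
  unitary because \<open>v\<^sup>* v = - (s + cnj s)\<close>.
\<close>
lemma unitary_reflection_exists:
  assumes a: "a \<in> carrier_vec D" and b: "b \<in> carrier_vec D" and ab: "a \<bullet>c a = b \<bullet>c b"
  shows "\<exists>W. unitary_op D W \<and> W *\<^sub>v b = a \<and>
    (\<forall>x \<in> carrier_vec D. x \<bullet>c a = x \<bullet>c b \<longrightarrow> W *\<^sub>v x = x)"
proof (cases "a = b")
  case True
  then show ?thesis using a by (intro exI[of _ "1\<^sub>m D"]) (auto simp: unitary_op_one)
next
  case False
  define v where "v = a - b"
  have v: "v \<in> carrier_vec D" using a b by (simp add: v_def)
  have conj_v: "conjugate v = conjugate a - conjugate b"
    using a b by (intro eq_vecI) (auto simp: v_def)
  have cv: "x \<bullet>c v = x \<bullet>c a - x \<bullet>c b" if "x \<in> carrier_vec D" for x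
    using that a b by (simp add: conj_v scalar_prod_minus_distrib[of _ D])
  define s where "s = b \<bullet>c v"
  define K where "K = ketbra v v"
  define W where "W = 1\<^sub>m D + (1 / s) \<cdot>\<^sub>m K"
  have cnj_prod: "cnj (x \<bullet>c y) = y \<bullet>c x" if "x \<in> carrier_vec D" "y \<in> carrier_vec D"
    for x y :: "complex vec"
    using that by (auto simp: scalar_prod_def ac_simps intro!: sum.cong)
  \<comment> \<open>Since \<open>a\<close> and \<open>b\<close> have equal length,
    \<open>a \<bullet>c v\<close> equals \<open>- cnj s\<close>, while \<open>b \<bullet>c v\<close>
    is \<open>s\<close> by definition.\<close>
  have vv: "v \<bullet>c v = - (s + cnj s)"
  proof -
    have "v \<bullet>c v = a \<bullet>c v - b \<bullet>c v"
      using a b v unfolding v_def by (intro minus_scalar_prod_distrib[of _ D]) auto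
    then show ?thesis
      using a b ab by (simp add: s_def cv cnj_prod)
  qed
  have s0: "s \<noteq> 0"
  proof
    assume "s = 0"
    then have "v \<bullet>c v = 0" using vv by simp
    then have "v = 0\<^sub>v D" using conjugate_square_eq_0_vec[OF v] by simp
    have "a $ i = b $ i" if "i < D" for i
      using arg_cong[OF \<open>v = 0\<^sub>v D\<close>, of "\<lambda>w. w $ i"] that a b by (simp add: v_def)
    then have "a = b" using a b by (intro eq_vecI) auto
    then show False using False by simp
  qed
  have K: "K \<in> carrier_mat D D" using v by (simp add: K_def)
  have W: "W \<in> carrier_mat D D" using K by (simp add: W_def)
  have KK: "K * K = (v \<bullet>c v) \<cdot>\<^sub>m K" by (simp add: K_def ketbra_mult_ketbra)
  \<comment> \<open>As \<open>K * K\<close> is a multiple of \<open>K\<close>, inverting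
    \<open>1 + p K\<close> reduces to a scalar equation. It is used with \<open>1 / s\<close> and
    its conjugate, in both orders.\<close>
  have prod1: "(1\<^sub>m D + p \<cdot>\<^sub>m K) * (1\<^sub>m D + q \<cdot>\<^sub>m K) = 1\<^sub>m D"
    if pq: "p + q + p * q * (v \<bullet>c v) = 0" for p q
  proof -
    have "(1\<^sub>m D + p \<cdot>\<^sub>m K) * (1\<^sub>m D + q \<cdot>\<^sub>m K)
        = 1\<^sub>m D * (1\<^sub>m D + q \<cdot>\<^sub>m K) + (p \<cdot>\<^sub>m K) * (1\<^sub>m D + q \<cdot>\<^sub>m K)"
      using K by (intro add_mult_distrib_mat[of _ D D]) auto
    also have "(p \<cdot>\<^sub>m K) * (1\<^sub>m D + q \<cdot>\<^sub>m K) = (p \<cdot>\<^sub>m K) * 1\<^sub>m D + (p \<cdot>\<^sub>m K) * (q \<cdot>\<^sub>m K)"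
      using K by (intro mult_add_distrib_mat[of _ D D]) auto
    also have "(p \<cdot>\<^sub>m K) * (q \<cdot>\<^sub>m K) = (p * q) \<cdot>\<^sub>m (K * K)"
      by (rule smult_mult_smult_mat[OF K K])
    also have "1\<^sub>m D * (1\<^sub>m D + q \<cdot>\<^sub>m K) + ((p \<cdot>\<^sub>m K) * 1\<^sub>m D + (p * q) \<cdot>\<^sub>m (K * K))
        = 1\<^sub>m D + (p + q + p * q * (v \<bullet>c v)) \<cdot>\<^sub>m K"
      using K KK by (intro eq_matI) (auto simp: algebra_simps)
    also have "\<dots> = 1\<^sub>m D" using K by (intro eq_matI) (auto simp: pq)
    finally show ?thesis .
  qed
  have adj: "mat_adjoint W = 1\<^sub>m D + cnj (1 / s) \<cdot>\<^sub>m K"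
    using K by (simp add: W_def mat_adjoint_add[of _ D D] mat_adjoint_smult K_def mat_adjoint_ketbra)
  have "unitary_op D W"
  proof -
    have "1 / s + cnj (1 / s) + 1 / s * cnj (1 / s) * (v \<bullet>c v) = 0"
      using s0 by (simp add: vv field_simps)
    moreover from this have "cnj (1 / s) + 1 / s + cnj (1 / s) * (1 / s) * (v \<bullet>c v) = 0"
      by (simp only: ac_simps)
    ultimately show ?thesis
      using W unfolding unitary_op_def adj unfolding W_def by (simp only: prod1 simp_thms)
  qed
  moreover have act: "W *\<^sub>v x = x + ((x \<bullet>c v) / s) \<cdot>\<^sub>v v" if x: "x \<in> carrier_vec D" for x
  proof -
    have "W *\<^sub>v x = 1\<^sub>m D *\<^sub>v x + ((1 / s) \<cdot>\<^sub>m K) *\<^sub>v x"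
      using K x unfolding W_def by (intro add_mult_distrib_mat_vec[of _ D D]) auto
    also have "((1 / s) \<cdot>\<^sub>m K) *\<^sub>v x = (1 / s) \<cdot>\<^sub>v (K *\<^sub>v x)"
      using K x by (intro eq_vecI) auto
    also have "K *\<^sub>v x = (x \<bullet>c v) \<cdot>\<^sub>v v" using x v by (simp add: K_def ketbra_mult_vec)
    finally show ?thesis using x v by (simp add: smult_smult_assoc)
  qed
  moreover have "W *\<^sub>v b = a"
  proof -
    \<comment> \<open>The coefficient of \<open>v\<close> is \<open>s / s = 1\<close>; this is what
      the choice of \<open>s\<close> is for.\<close>
    have "W *\<^sub>v b = b + v" using act[OF b] s0 by (simp add: s_def)
    also have "\<dots> = a" using a b by (intro eq_vecI) (auto simp: v_def)
    finally show ?thesis .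
  qed
  moreover have "W *\<^sub>v x = x" if "x \<in> carrier_vec D" "x \<bullet>c a = x \<bullet>c b" for x
    using that v act[of x] by (simp add: cv) (intro eq_vecI, auto)
  ultimately show ?thesis by blast
qed

text \<open>
  The columns are matched one after the other. Equality of the Gram matrices makes the columns that
  are already matched orthogonal to the vector of the next reflection, which therefore fixes them.
\<close>
lemma unitary_if_gram_eq:
  assumes A: "A \<in> carrier_mat D e" and B: "B \<in> carrier_mat D e"
    and gram: "mat_adjoint A * A = mat_adjoint B * B"
  shows "\<exists>U. unitary_op D U \<and> A = U * B"
proof -
  have gramc: "col A j \<bullet>c col A i = col B j \<bullet>c col B i" if "i < e" "j < e" for i j
    using adjoint_times_self_index[OF A that] adjoint_times_self_index[OF B that] gram by simp
  have colA: "col A j \<in> carrier_vec D" and colB: "col B j \<in> carrier_vec D" for j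
    using A B by auto
  have "\<exists>U. unitary_op D U \<and> (\<forall>j<k. U *\<^sub>v col B j = col A j)" if "k \<le> e" for k
    using that
  proof (induction k)
    case 0
    show ?case using unitary_op_one by auto
  next
    case (Suc k)
    then obtain U where U: "unitary_op D U" and UB: "\<And>j. j < k \<Longrightarrow> U *\<^sub>v col B j = col A j"
      by auto
    note Uc = unitary_op_carrier[OF U]
    define b where "b = U *\<^sub>v col B k"
    have b: "b \<in> carrier_vec D" using Uc colB by (simp add: b_def)
    \<comment> \<open>\<open>U\<close> preserves inner products and the diagonals of the Gram
      matrices agree, so the two vectors have the equal length that a reflection requires.\<close>
    have "col A k \<bullet>c col A k = b \<bullet>c b"
      using Suc.prems by (simp add: b_def unitary_op_cscalar_prod[OF U colB colB] gramc)
    from unitary_reflection_exists[OF colA b this] obtain W where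
      W: "unitary_op D W" "W *\<^sub>v b = col A k"
      and fixes_W: "\<And>x. x \<in> carrier_vec D \<Longrightarrow> x \<bullet>c col A k = x \<bullet>c b \<Longrightarrow> W *\<^sub>v x = x"
      by blast
    note Wc = unitary_op_carrier[OF W(1)]
    have fixA: "W *\<^sub>v col A j = col A j" if j: "j < k" for j
    proof (rule fixes_W[OF colA])
      have "col A j \<bullet>c col A k = col B j \<bullet>c col B k" using j Suc.prems by (intro gramc) auto
      also have "\<dots> = (U *\<^sub>v col B j) \<bullet>c b"
        by (simp add: b_def unitary_op_cscalar_prod[OF U colB colB])
      finally show "col A j \<bullet>c col A k = col A j \<bullet>c b" by (simp add: UB j)
    qed
    have "(W * U) *\<^sub>v col B j = col A j" if "j < Suc k" for j
    proof -
      have "(W * U) *\<^sub>v col B j = W *\<^sub>v (U *\<^sub>v col B j)"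
        using Wc Uc colB by (intro assoc_mult_mat_vec) auto
      then show ?thesis
        using that fixA W(2) UB by (cases "j = k") (auto simp: b_def)
    qed
    then show ?case using unitary_op_mult[OF W(1) U] by blast
  qed
  from this[OF order_refl] obtain U where U: "unitary_op D U"
    and UB: "\<And>j. j < e \<Longrightarrow> U *\<^sub>v col B j = col A j" by auto
  have "A = U * B"
  proof (rule mat_col_eqI)
    fix j assume "j < dim_col (U * B)"
    then have j: "j < e" using B by simp
    have "col (U * B) j = U *\<^sub>v col B j" using unitary_op_carrier[OF U] B j by (intro col_mult2) auto
    then show "col A j = col (U * B) j" using UB[OF j] by simp
  qed (use A B unitary_op_carrier[OF U] in auto)
  then show ?thesis using U by blast
qed

section \<open>Purifications of density operators\<close>

text \<open>The sesquilinear form of a matrix, conjugate-linear in the first vector. Matrices and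
  vectors are plain functions here, which makes updating single entries during the elimination
  easy.\<close>

definition sesq :: "nat \<Rightarrow> (nat \<Rightarrow> nat \<Rightarrow> complex) \<Rightarrow> (nat \<Rightarrow> complex) \<Rightarrow> (nat \<Rightarrow> complex) \<Rightarrow> complex" where
  "sesq N A u v = (\<Sum>i<N. \<Sum>j<N. cnj (u i) * A i j * v j)"

lemma sesq_add_left: "sesq N A (\<lambda>i. u i + u' i) v = sesq N A u v + sesq N A u' v"
  and sesq_add_right: "sesq N A u (\<lambda>i. v i + v' i) = sesq N A u v + sesq N A u v'"
  and sesq_smult_left: "sesq N A (\<lambda>i. t * u i) v = cnj t * sesq N A u v"
  and sesq_smult_right: "sesq N A u (\<lambda>i. t * v i) = t * sesq N A u v"
  by (simp_all add: sesq_def sum.distrib algebra_simps sum_distrib_left)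

lemma sesq_add_smult:
  "sesq N A (\<lambda>i. u i + t * v i) (\<lambda>i. u i + t * v i) =
     sesq N A u u + t * sesq N A u v + cnj t * sesq N A v u + t * cnj t * sesq N A v v"
  by (simp add: sesq_add_left sesq_add_right sesq_smult_left sesq_smult_right algebra_simps)

lemma sesq_unit_left: "k < N \<Longrightarrow> sesq N A (\<lambda>i. of_bool (i = k)) v = (\<Sum>j<N. A k j * v j)"
proof -
  assume k: "k < N"
  have "sesq N A (\<lambda>i. of_bool (i = k)) v = (\<Sum>i<N. if i = k then \<Sum>j<N. A i j * v j else 0)"
    unfolding sesq_def by (intro sum.cong) auto
  then show ?thesis using k by simp
qed

lemma sesq_unit_right: "k < N \<Longrightarrow> sesq N A u (\<lambda>i. of_bool (i = k)) = (\<Sum>i<N. cnj (u i) * A i k)"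
proof -
  assume k: "k < N"
  have "(\<Sum>j<N. cnj (u i) * A i j * of_bool (j = k)) = cnj (u i) * A i k" for i
  proof -
    have "(\<Sum>j<N. cnj (u i) * A i j * of_bool (j = k)) = (\<Sum>j<N. if j = k then cnj (u i) * A i j else 0)"
      by (intro sum.cong) auto
    then show ?thesis using k by simp
  qed
  then show ?thesis by (simp add: sesq_def)
qed

lemma sesq_unit_unit:
  "k < N \<Longrightarrow> l < N \<Longrightarrow> sesq N A (\<lambda>i. of_bool (i = k)) (\<lambda>i. of_bool (i = l)) = A k l"
proof -
  assume kl: "k < N" "l < N"
  have "(\<Sum>j<N. A k j * of_bool (j = l)) = (\<Sum>j<N. if j = l then A k j else 0)"
    by (intro sum.cong) auto
  then show ?thesis using kl by (simp add: sesq_unit_left)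
qed

text \<open>The order on the complex numbers also forces the values to be real; Hermitian symmetry
  is derived from this below.\<close>

definition psd :: "nat \<Rightarrow> (nat \<Rightarrow> nat \<Rightarrow> complex) \<Rightarrow> bool" where
  "psd N A \<longleftrightarrow> (\<forall>v. 0 \<le> sesq N A v v)"

text \<open>Polarisation: the form is real at \<open>u + t v\<close> for every \<open>t\<close>. The
  choice \<open>t = 1\<close> relates the imaginary parts of the two mixed terms, and
  \<open>t = \<i>\<close> relates the real parts.\<close>

lemma psd_sesq_commute:
  assumes "psd N A"
  shows "sesq N A v u = cnj (sesq N A u v)"
proof -
  have im: "Im (sesq N A w w) = 0" for w
    using assms by (auto simp: psd_def less_eq_complex_def)
  have "Im (t * sesq N A u v + cnj t * sesq N A v u) = 0" for t
    using im[of "\<lambda>i. u i + t * v i"] im[of u] im[of v] unfolding sesq_add_smult by simp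
  from this[of 1] this[of \<i>] show ?thesis by (simp add: complex_eq_iff)
qed

text \<open>A null vector \<open>w\<close> lies in the kernel of the form: otherwise the value at
  \<open>u + t w\<close> would be affine and nonconstant in \<open>t\<close>, hence negative for a
  suitable \<open>t\<close>.\<close>

lemma psd_sesq_eq_0:
  assumes psd: "psd N A" and w: "sesq N A w w = 0"
  shows "sesq N A u w = 0"
proof (rule ccontr)
  define B where "B = sesq N A u w"
  define q where "q = Re (sesq N A u u)"
  assume "sesq N A u w \<noteq> 0"
  then have B: "B \<noteq> 0" by (simp add: B_def)
  \<comment> \<open>Chosen so that the mixed terms add up to \<open>- (q + 1)\<close>, which makes
    the real part of the value exactly \<open>- 1\<close>.\<close>
  define t where "t = - complex_of_real (q + 1) / (2 * B)"
  have tB: "t * B = - complex_of_real (q + 1) / 2" using B by (simp add: t_def)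
  have "sesq N A (\<lambda>i. u i + t * w i) (\<lambda>i. u i + t * w i) = sesq N A u u + t * B + cnj (t * B)"
    unfolding sesq_add_smult w by (simp add: B_def psd_sesq_commute[OF psd, of w u])
  then have "Re (sesq N A (\<lambda>i. u i + t * w i) (\<lambda>i. u i + t * w i)) = - 1"
    unfolding tB by (simp add: q_def)
  moreover have "0 \<le> sesq N A (\<lambda>i. u i + t * w i) (\<lambda>i. u i + t * w i)"
    using psd by (simp add: psd_def)
  ultimately show False by (simp add: less_eq_complex_def)
qed

text \<open>One step of the Cholesky elimination: subtract a rank-one matrix that clears row and column \<open>m\<close>.\<close>
lemma psd_factorization_aux:
  assumes "m \<le> N" "psd N A" "\<And>i j. i < N \<Longrightarrow> j < N \<Longrightarrow> i < m \<or> j < m \<Longrightarrow> A i j = 0"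
  shows "\<exists>C. \<forall>i<N. \<forall>j<N. A i j = (\<Sum>k=m..<N. C i k * cnj (C j k))"
  using assms
\<comment> \<open>The induction descends from \<open>m = N\<close>, where all entries are zero and
  the sum is empty, to smaller \<open>m\<close>. The matrix varies because each step subtracts from
  it.\<close>
proof (induction m arbitrary: A rule: inc_induct)
  case base
  then show ?case by auto
next
  case (step m)
  note psd = step.prems(1) and zero = step.prems(2)
  have m: "m < N" using step.hyps by simp
  define e where "e = (\<lambda>i. of_bool (i = m) :: complex)"
  have ee: "sesq N A e e = A m m" unfolding e_def using m by (simp add: sesq_unit_unit)
  have herm: "A j i = cnj (A i j)" if "i < N" "j < N" for i j
    using psd_sesq_commute[OF psd, of "\<lambda>x. of_bool (x = j)" "\<lambda>x. of_bool (x = i)"] that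
    by (simp add: sesq_unit_unit)
  have "0 \<le> A m m" using psd ee by (metis psd_def)
  then obtain r where r: "0 \<le> r" "A m m = complex_of_real r"
    by (intro that[of "Re (A m m)"]) (auto simp: less_eq_complex_def complex_eq_iff)
  show ?case
  proof (cases "r = 0")
    case True
    then have "sesq N A e e = 0" using ee r by simp
    \<comment> \<open>A vanishing pivot makes \<open>e\<close> a null vector, so the whole column
      \<open>m\<close> is zero; by symmetry so is the row, and there is nothing to subtract.\<close>
    have col: "A i m = 0" if "i < N" for i
      using psd_sesq_eq_0[OF psd \<open>sesq N A e e = 0\<close>, of "\<lambda>x. of_bool (x = i)"] that m
      by (simp add: e_def sesq_unit_unit)
    have zero': "A i j = 0" if "i < N" "j < N" "i < Suc m \<or> j < Suc m" for i j
      using zero[of i j] col[of i] col[of j] herm[of j i] that by (cases "i = m"; cases "j = m") auto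
    then obtain C where C: "\<And>i j. i < N \<Longrightarrow> j < N \<Longrightarrow> A i j = (\<Sum>k=Suc m..<N. C i k * cnj (C j k))"
      using step.IH[OF psd zero'] by auto
    \<comment> \<open>Coordinate \<open>m\<close> of every row of \<open>C\<close> is overwritten by
      0, so starting the sum at \<open>m\<close> instead of \<open>Suc m\<close> changes
      nothing.\<close>
    have "A i j = (\<Sum>k=m..<N. (C(i := (C i)(m := 0))) i k * cnj ((C(j := (C j)(m := 0))) j k))"
      if "i < N" "j < N" for i j
      using C[OF that] m by (simp add: sum.atLeast_Suc_lessThan)
    then show ?thesis
      by (intro exI[of _ "\<lambda>i. (C i)(m := 0)"]) simp
  next
    case False
    then have r0: "r > 0" using r by simp
    \<comment> \<open>The pivot column scaled by the root of the pivot; the products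
      \<open>c i * cnj (c j)\<close> then agree with \<open>A\<close> on row and column
      \<open>m\<close>. \<open>A'\<close> is the Schur complement.\<close>
    define c where "c = (\<lambda>i. A i m / complex_of_real (sqrt r))"
    define A' where "A' = (\<lambda>i j. A i j - c i * cnj (c j))"
    have sq: "complex_of_real (sqrt r) * complex_of_real (sqrt r) = complex_of_real r"
      using r0 by (simp flip: of_real_mult)
    have cc: "c i * cnj (c j) = A i m * A m j / complex_of_real r" if "i < N" "j < N" for i j
      using herm[of j m] that m by (simp add: c_def sq)
    have psd': "psd N A'"
      unfolding psd_def
    proof
      fix v
      \<comment> \<open>Completing the square: this \<open>t\<close> minimises the form of
        \<open>A\<close> at \<open>v + t e\<close>, and the minimum is the form of \<open>A'\<close>
        at \<open>v\<close>.\<close>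
      define t where "t = - (sesq N A e v / complex_of_real r)"
      have "sesq N A' v v = sesq N A v v - (\<Sum>i<N. \<Sum>j<N. cnj (v i) * (A i m * A m j / complex_of_real r) * v j)"
        unfolding sesq_def A'_def
        by (simp add: cc algebra_simps sum_subtractf)
      also have "(\<Sum>i<N. \<Sum>j<N. cnj (v i) * (A i m * A m j / complex_of_real r) * v j)
          = (\<Sum>i<N. cnj (v i) * A i m) * (\<Sum>j<N. A m j * v j) / complex_of_real r"
        by (simp add: sum_product sum_divide_distrib mult.assoc)
      also have "\<dots> = sesq N A v e * sesq N A e v / complex_of_real r"
        unfolding e_def using m by (simp add: sesq_unit_left sesq_unit_right)
      also have "sesq N A v v - \<dots> = sesq N A (\<lambda>i. v i + t * e i) (\<lambda>i. v i + t * e i)"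
        unfolding sesq_add_smult t_def ee r psd_sesq_commute[OF psd, of v e]
        using r0 by (simp add: field_simps)
      finally show "0 \<le> sesq N A' v v" using psd by (simp add: psd_def)
    qed
    have zero': "A' i j = 0" if "i < N" "j < N" "i < Suc m \<or> j < Suc m" for i j
      using that zero[of i j] zero[of i m] zero[of m j] m r0 r(2)
      by (cases "i = m"; cases "j = m") (auto simp: A'_def cc)
    obtain C where
      C: "\<And>i j. i < N \<Longrightarrow> j < N \<Longrightarrow> A' i j = (\<Sum>k=Suc m..<N. C i k * cnj (C j k))"
      using step.IH[OF psd' zero'] by auto
    have "A i j = (\<Sum>k=m..<N. ((C i)(m := c i)) k * cnj (((C j)(m := c j)) k))"
      if "i < N" "j < N" for i j
      using C[OF that] m by (simp add: sum.atLeast_Suc_lessThan A'_def algebra_simps)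
    then show ?thesis
      by (intro exI[of _ "\<lambda>i. (C i)(m := c i)"]) simp
  qed
qed

lemma psd_factorization:
  assumes "psd N A"
  shows "\<exists>C. \<forall>i<N. \<forall>j<N. A i j = (\<Sum>k<N. C i k * cnj (C j k))"
  using psd_factorization_aux[of 0 N A] assms by (simp add: atLeast0LessThan)

text \<open>Factor the operator as \<open>C\<close> times its adjoint and read the entries of
  \<open>C\<close> as the amplitudes of a vector. Eve's system then has the same dimension as the
  purified system.\<close>

lemma density_operator_purification:
  assumes "density_operator N \<rho>"
  shows "\<exists>\<Psi>. purification N N \<rho> \<Psi>"
proof -
  have \<rho>: "\<rho> \<in> carrier_mat N N" and pos: "\<And>v. v \<in> carrier_vec N \<Longrightarrow> 0 \<le> (\<rho> *\<^sub>v v) \<bullet>c v"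
    using assms by (auto simp: density_operator_def)
  have "psd N (\<lambda>i j. \<rho> $$ (i, j))"
    unfolding psd_def
  proof
    fix v
    have "sesq N (\<lambda>i j. \<rho> $$ (i, j)) v v = (\<rho> *\<^sub>v vec N v) \<bullet>c vec N v"
      using \<rho> by (auto simp: sesq_def scalar_prod_def atLeast0LessThan sum_distrib_left ac_simps intro!: sum.cong)
    then show "0 \<le> sesq N (\<lambda>i j. \<rho> $$ (i, j)) v v" using pos[of "vec N v"] by simp
  qed
  from psd_factorization[OF this] obtain C where
    C: "\<And>i j. i < N \<Longrightarrow> j < N \<Longrightarrow> \<rho> $$ (i, j) = (\<Sum>k<N. C i k * cnj (C j k))" by blast
  have lt: "i * N + k < N * N" if "i < N" "k < N" for i k
  proof -
    have "i * N + k < Suc i * N" using that by simp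
    also have "\<dots> \<le> N * N" using that by (intro mult_le_mono1) auto
    finally show ?thesis .
  qed
  have "purification N N \<rho> (vec (N * N) (\<lambda>x. C (x div N) (x mod N)))"
    unfolding purification_def
    using \<rho> by (auto intro!: eq_matI sum.cong simp: ptrace_snd_def ketbra_def C lt)
  then show ?thesis by blast
qed

section \<open>Blocks with respect to the standard basis\<close>

lemma block_index_less: "i < m \<Longrightarrow> a < k \<Longrightarrow> i * k + a < m * (k :: nat)"
proof -
  assume "i < m" "a < k"
  then have "i * k + a < Suc i * k" by simp
  also have "\<dots> \<le> m * k" using \<open>i < m\<close> by (intro mult_le_mono1) auto
  finally show ?thesis .
qed

lemma block_index_cases:
  assumes "x < m * (k :: nat)"
  obtains i a where "i < m" "a < k" "x = i * k + a"
proof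
  show "x = (x div k) * k + x mod k" by simp
  show "x div k < m" using assms by (simp add: less_mult_imp_div_less)
  show "x mod k < k" using assms by (cases "k = 0") auto
qed

definition block_vec :: "nat \<Rightarrow> nat \<Rightarrow> complex vec \<Rightarrow> complex vec" where
  "block_vec k i \<Psi> = vec k (\<lambda>x. \<Psi> $ (i * k + x))"

definition block_mat :: "nat \<Rightarrow> complex mat \<Rightarrow> nat \<Rightarrow> nat \<Rightarrow> complex mat" where
  "block_mat D M i j = mat D D (\<lambda>(a, b). M $$ (i * D + a, j * D + b))"

text \<open>A vector of \<open>\<complex>\<^sup>D \<otimes> \<complex>\<^sup>e\<close> read as a \<open>D \<times> e\<close> matrix, so that partial traces become matrix products.\<close>
definition mat_of_vec :: "nat \<Rightarrow> nat \<Rightarrow> complex vec \<Rightarrow> complex mat" where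
  "mat_of_vec D e \<phi> = mat D e (\<lambda>(a, k). \<phi> $ (a * e + k))"

lemma block_vec_carrier [simp]: "block_vec k i \<Psi> \<in> carrier_vec k"
  by (simp add: block_vec_def)

lemma block_mat_carrier [simp]: "block_mat D M i j \<in> carrier_mat D D"
  by (simp add: block_mat_def)

lemma mat_of_vec_carrier [simp]: "mat_of_vec D e \<phi> \<in> carrier_mat D e"
  by (simp add: mat_of_vec_def)

lemma mat_of_vec_dim [simp]:
  "dim_row (mat_of_vec D e \<phi>) = D" "dim_col (mat_of_vec D e \<phi>) = e"
  by (simp_all add: mat_of_vec_def)

lemma eq_vec_if_blocks_eq:
  assumes "u \<in> carrier_vec (m * k)" "v \<in> carrier_vec (m * k)"
    and "\<And>i. i < m \<Longrightarrow> block_vec k i u = block_vec k i v"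
  shows "u = v"
proof (rule eq_vecI)
  fix x assume "x < dim_vec v"
  then obtain i a where x: "i < m" "a < k" "x = i * k + a"
    using assms(2) by (auto elim: block_index_cases)
  then show "u $ x = v $ x"
    using arg_cong[OF assms(3)[OF x(1)], of "\<lambda>w. w $ a"] by (simp add: block_vec_def)
qed (use assms in auto)

lemma eq_mat_if_blocks_eq:
  assumes "M \<in> carrier_mat (m * D) (m * D)" "N \<in> carrier_mat (m * D) (m * D)"
    and "\<And>i j. i < m \<Longrightarrow> j < m \<Longrightarrow> block_mat D M i j = block_mat D N i j"
  shows "M = N"
proof (rule eq_matI)
  fix x y assume "x < dim_row N" "y < dim_col N"
  then have "x < m * D" "y < m * D" using assms(2) by auto
  then obtain i a j b where x: "i < m" "a < D" "x = i * D + a" and y: "j < m" "b < D" "y = j * D + b"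
    by (auto elim!: block_index_cases)
  then show "M $$ (x, y) = N $$ (x, y)"
    using arg_cong[OF assms(3)[OF x(1) y(1)], of "\<lambda>w. w $$ (a, b)"] by (simp add: block_mat_def)
qed (use assms in auto)

text \<open>Tracing out Eve sums over the column index of the reshaped vectors, which is a matrix
  product with an adjoint.\<close>

lemma purification_block_mat:
  assumes "purification (m * D) e \<rho> \<Psi>" "i < m" "j < m"
  shows "block_mat D \<rho> i j =
    mat_of_vec D e (block_vec (D * e) i \<Psi>) * mat_adjoint (mat_of_vec D e (block_vec (D * e) j \<Psi>))"
proof (rule eq_matI)
  fix a b
  assume "a < dim_row (mat_of_vec D e (block_vec (D * e) i \<Psi>) * mat_adjoint (mat_of_vec D e (block_vec (D * e) j \<Psi>)))"
    and "b < dim_col (mat_of_vec D e (block_vec (D * e) i \<Psi>) * mat_adjoint (mat_of_vec D e (block_vec (D * e) j \<Psi>)))"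
  then have ab: "a < D" "b < D" by auto
  have \<Psi>: "\<Psi> \<in> carrier_vec (m * D * e)" and \<rho>: "\<rho> = ptrace_snd (m * D) e (ketbra \<Psi> \<Psi>)"
    using assms(1) by (auto simp: purification_def)
  have idx: "i * D + a < m * D" "j * D + b < m * D" using assms ab by (auto intro: block_index_less)
  have idx2: "(i * D + a) * e + k < m * D * e" "(j * D + b) * e + k < m * D * e"
    "a * e + k < D * e" "b * e + k < D * e" if "k < e" for k
    using idx that ab by (auto intro: block_index_less)
  have "block_mat D \<rho> i j $$ (a, b) = (\<Sum>k<e. \<Psi> $ ((i * D + a) * e + k) * cnj (\<Psi> $ ((j * D + b) * e + k)))"
    using ab idx idx2 \<Psi> by (auto simp: block_mat_def \<rho> ptrace_snd_def ketbra_def intro!: sum.cong)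
  \<comment> \<open>The index is regrouped: \<open>(i * D + a) * e + k\<close> equals
    \<open>i * (D * e) + (a * e + k)\<close>.\<close>
  also have "\<dots> = (mat_of_vec D e (block_vec (D * e) i \<Psi>) * mat_adjoint (mat_of_vec D e (block_vec (D * e) j \<Psi>))) $$ (a, b)"
    using ab idx2 by (auto simp: scalar_prod_def mat_of_vec_def block_vec_def atLeast0LessThan algebra_simps intro!: sum.cong)
  finally show "block_mat D \<rho> i j $$ (a, b) = (mat_of_vec D e (block_vec (D * e) i \<Psi>) * mat_adjoint (mat_of_vec D e (block_vec (D * e) j \<Psi>))) $$ (a, b)" .
qed (auto simp: block_mat_def)

lemma mat_of_vec_smult:
  "\<phi> \<in> carrier_vec (D * e) \<Longrightarrow> mat_of_vec D e (c \<cdot>\<^sub>v \<phi>) = c \<cdot>\<^sub>m mat_of_vec D e \<phi>"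
  by (intro eq_matI) (auto simp: mat_of_vec_def block_index_less)

text \<open>Here the sum runs over the row index. The transpose arises because \<open>ketbra\<close>
  conjugates the entry with the column index, whereas in the Gram matrix the entry with the row
  index is conjugated.\<close>

lemma eve_state_eq_transpose:
  assumes "\<phi> \<in> carrier_vec (D * e)"
  shows "eve_state D e \<phi> = transpose_mat (mat_adjoint (mat_of_vec D e \<phi>) * mat_of_vec D e \<phi>)"
  using assms
  by (intro eq_matI)
    (auto simp: eve_state_def ptrace_fst_def ketbra_def mat_of_vec_def scalar_prod_def
      atLeast0LessThan block_index_less mult.commute intro!: sum.cong)

section \<open>Traces\<close>

lemma sum_blocks:
  fixes f :: "nat \<Rightarrow> 'a :: comm_monoid_add"
  shows "(\<Sum>x<m * k. f x) = (\<Sum>i<m. \<Sum>a<k. f (i * k + a))"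
proof -
  have "sum f {i * k..<i * k + k} = (\<Sum>a<k. f (i * k + a))" for i
    using sum.atLeastLessThan_shift_0[of f "i * k" "i * k + k"] by (simp add: atLeast0LessThan)
  then show ?thesis by (simp flip: sum.nat_group)
qed

text \<open>The trace is the squared Frobenius norm, and reshaping a vector only renames its
  entries. Unit vectors thus yield trace one.\<close>

lemma trace_mat_of_vec:
  assumes "\<phi> \<in> carrier_vec (D * e)"
  shows "trace_mat (mat_of_vec D e \<phi> * mat_adjoint (mat_of_vec D e \<phi>)) = \<phi> \<bullet>c \<phi>"
proof -
  have "\<phi> \<bullet>c \<phi> = (\<Sum>x<D * e. \<phi> $ x * cnj (\<phi> $ x))"
    using assms by (auto simp: scalar_prod_def atLeast0LessThan)
  also have "\<dots> = trace_mat (mat_of_vec D e \<phi> * mat_adjoint (mat_of_vec D e \<phi>))"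
    unfolding sum_blocks
    by (auto simp: trace_mat_def scalar_prod_def mat_of_vec_def atLeast0LessThan intro!: sum.cong)
  finally show ?thesis by simp
qed

lemma trace_mat_commute:
  assumes "A \<in> carrier_mat m n" "B \<in> carrier_mat n m"
  shows "trace_mat (A * B) = trace_mat (B * A)"
proof -
  have "trace_mat (A * B) = (\<Sum>i<m. \<Sum>j<n. A $$ (i, j) * B $$ (j, i))"
    using assms by (auto simp: trace_mat_def scalar_prod_def atLeast0LessThan intro!: sum.cong)
  also have "\<dots> = (\<Sum>j<n. \<Sum>i<m. A $$ (i, j) * B $$ (j, i))" by (rule sum.swap)
  also have "\<dots> = trace_mat (B * A)"
    using assms by (auto simp: trace_mat_def scalar_prod_def atLeast0LessThan ac_simps intro!: sum.cong)
  finally show ?thesis .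
qed

lemma trace_mat_smult: "A \<in> carrier_mat D D \<Longrightarrow> trace_mat (c \<cdot>\<^sub>m A) = c * trace_mat A"
  by (auto simp: trace_mat_def sum_distrib_left)

lemma trace_mat_zero [simp]: "trace_mat (0\<^sub>m D D) = 0"
  by (simp add: trace_mat_def)

lemma trace_mat_unitary_conj:
  assumes "unitary_op D U" "\<sigma> \<in> carrier_mat D D"
  shows "trace_mat (U * \<sigma> * mat_adjoint U) = trace_mat \<sigma>"
proof -
  note U = unitary_op_carrier[OF assms(1)]
  have "trace_mat (U * \<sigma> * mat_adjoint U) = trace_mat (mat_adjoint U * (U * \<sigma>))"
    using U assms(2) by (intro trace_mat_commute) auto
  also have "mat_adjoint U * (U * \<sigma>) = (mat_adjoint U * U) * \<sigma>"
    using U assms(2) by (intro assoc_mult_mat[symmetric]) auto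
  finally show ?thesis using assms by (simp add: unitary_op_def)
qed

text \<open>All four terms of \<open>(A - B) (A - B)\<^sup>*\<close> cancel.\<close>
lemma mat_eq_if_gram_eq:
  fixes A B :: "complex mat"
  assumes A: "A \<in> carrier_mat m n" and B: "B \<in> carrier_mat m n"
    and "A * mat_adjoint A = S" "A * mat_adjoint B = S" "B * mat_adjoint A = S" "B * mat_adjoint B = S"
  shows "A = B"
proof -
  \<comment> \<open>The adjoint is taken so that the Gram matrix of the columns of \<open>X\<close>
    is \<open>(A - B)\<close> times its adjoint; its zero diagonal then kills every column.\<close>
  define X where "X = mat_adjoint (A - B)"
  have X: "X \<in> carrier_mat n m" using minus_carrier_mat[OF B] by (simp add: X_def)
  have S: "S \<in> carrier_mat m m" using A assms(3) by auto
  have adjX: "mat_adjoint X = A - B" "X = mat_adjoint A - mat_adjoint B"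
    by (simp_all add: X_def mat_adjoint_minus[OF A B, symmetric])
  have "mat_adjoint X * X = (A - B) * (mat_adjoint A - mat_adjoint B)"
    by (rule arg_cong2[of _ _ _ _ "(*)", OF adjX])
  also have "\<dots> = A * (mat_adjoint A - mat_adjoint B) - B * (mat_adjoint A - mat_adjoint B)"
    using A B by (intro minus_mult_distrib_mat[of _ m n _ _ m]) auto
  also have "A * (mat_adjoint A - mat_adjoint B) = S - S"
    using A B assms by (subst mult_minus_distrib_mat[of _ m n _ m]) auto
  also have "B * (mat_adjoint A - mat_adjoint B) = S - S"
    using A B assms by (subst mult_minus_distrib_mat[of _ m n _ m]) auto
  finally have XX: "mat_adjoint X * X = 0\<^sub>m m m"
    using S by simp
  have "X = 0\<^sub>m n m"
  proof (rule mat_col_eqI)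
    fix i assume "i < dim_col (0\<^sub>m n m :: complex mat)"
    then have i: "i < m" by simp
    have "col X i \<bullet>c col X i = 0"
      using adjoint_times_self_index[OF X i i] XX i by simp
    then show "col X i = col (0\<^sub>m n m) i"
      using X i conjugate_square_eq_0_vec[of "col X i" n] by simp
  qed (use X in auto)
  then have "A - B = 0\<^sub>m m n"
    using adjX(1) by simp
  show ?thesis
  proof (rule eq_matI)
    fix i j assume "i < dim_row B" "j < dim_col B"
    then show "A $$ (i, j) = B $$ (i, j)"
      using arg_cong[OF \<open>A - B = 0\<^sub>m m n\<close>, of "\<lambda>w. w $$ (i, j)"] A B by simp
  qed (use A B in auto)
qed

section \<open>Finite sums of matrices\<close>

text \<open>Turns the sum in the module of matrices into ordinary sums of entries. Carrier and
  entries are proved together since the entry of a sum of two matrices needs the dimensions of the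
  partial sum.\<close>

lemma finsum_mat_carrier_index:
  assumes "finite S" "\<And>s. s \<in> S \<Longrightarrow> f s \<in> carrier_mat nr nc"
  shows "finsum_mat nr nc f S \<in> carrier_mat nr nc \<and>
    (\<forall>i<nr. \<forall>j<nc. finsum_mat nr nc f S $$ (i, j) = (\<Sum>s\<in>S. f s $$ (i, j)))"
proof -
  interpret abelian_group "module_mat TYPE(complex) nr nc" by (rule abelian_group_mat)
  show ?thesis
    using assms
  proof (induction S rule: finite_induct)
    case empty
    then show ?case by (simp add: finsum_mat_def module_mat_simps)
  next
    case (insert x S)
    have "finsum_mat nr nc f (insert x S) = f x + finsum_mat nr nc f S"
      unfolding finsum_mat_def using insert
      by (subst finsum_insert) (auto simp: module_mat_simps)
    then show ?case using insert by auto
  qed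
qed

section \<open>Bit strings and the basis vectors they label\<close>

text \<open>The binary value with the first bit most significant, as the Kronecker ordering in
  \<open>ket\<close> dictates.\<close>

primrec ket_index :: "bool list \<Rightarrow> nat" where
  "ket_index [] = 0"
| "ket_index (b # I) = of_bool b * 2 ^ length I + ket_index I"

lemma ket_index_less: "ket_index I < 2 ^ length I"
  by (induction I) auto

lemma tensor_vec_unit_vec:
  assumes "k < m" "l < n"
  shows "tensor_vec (unit_vec m k) (unit_vec n l) = unit_vec (m * n) (k * n + l)"
proof (rule eq_vecI)
  fix x assume "x < dim_vec (unit_vec (m * n) (k * n + l) :: complex vec)"
  then obtain i a where x: "i < m" "a < n" "x = i * n + a" by (auto elim: block_index_cases)
  have "i * n + a = k * n + l \<longleftrightarrow> i = k \<and> a = l"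
    using x assms by (metis div_mult_self3 div_less add.right_neutral gr_implies_not_zero mod_less mod_mult_self3)
  then show "tensor_vec (unit_vec m k) (unit_vec n l) $ x = unit_vec (m * n) (k * n + l) $ x"
    using x assms block_index_less[of i m a n] block_index_less[of k m l n]
    by (auto simp: tensor_vec_def)
qed (simp add: tensor_vec_def)

lemma ket_eq_unit_vec: "ket I = unit_vec (2 ^ length I) (ket_index I)"
  by (induction I) (auto simp: tensor_vec_unit_vec ket_index_less)

lemma ket_index_inj:
  "length I = length J \<Longrightarrow> ket_index I = ket_index J \<Longrightarrow> I = J"
proof (induction I J rule: list_induct2)
  case (Cons x xs y ys)
  have "x = y" using Cons.prems Cons.hyps ket_index_less[of xs] ket_index_less[of ys]
    by (cases x; cases y) auto
  then show ?case using Cons by auto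
qed simp

lemma finite_bit_strings [simp]: "finite (bit_strings n)"
  using finite_lists_length_eq[of "UNIV :: bool set" n] by (simp add: bit_strings_def)

lemma card_bit_strings: "card (bit_strings n) = 2 ^ n"
  using card_lists_length_eq[of "UNIV :: bool set" n] by (simp add: bit_strings_def card_UNIV_bool)

text \<open>An injection from a set of \<open>2 ^ n\<close> strings into the \<open>2 ^ n\<close>
  indices is onto.\<close>

lemma ket_index_surj:
  assumes "i < 2 ^ n"
  obtains I where "I \<in> bit_strings n" "ket_index I = i"
proof -
  have "inj_on ket_index (bit_strings n)"
    by (auto intro!: inj_onI ket_index_inj simp: bit_strings_def)
  then have "card (ket_index ` bit_strings n) = 2 ^ n"
    by (simp add: card_image card_bit_strings)
  moreover have "ket_index ` bit_strings n \<subseteq> {..<2 ^ n}"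
    using ket_index_less by (auto simp: bit_strings_def)
  ultimately have "ket_index ` bit_strings n = {..<2 ^ n}"
    by (intro card_subset_eq) auto
  then show ?thesis using assms that by (metis imageE lessThan_iff)
qed

section \<open>Blocks of tensor products and of their sums\<close>

lemma block_vec_tensor_vec:
  assumes "u \<in> carrier_vec m" "v \<in> carrier_vec k" "i < m"
  shows "block_vec k i (tensor_vec u v) = u $ i \<cdot>\<^sub>v v"
  using assms by (intro eq_vecI) (auto simp: block_vec_def tensor_vec_def block_index_less)

lemma block_vec_tensor_ket:
  assumes "I \<in> bit_strings n" "K \<in> bit_strings n" "v \<in> carrier_vec k"
  shows "block_vec k (ket_index K) (tensor_vec (ket I) v) = (if I = K then v else 0\<^sub>v k)"
proof -
  have len: "length I = n" "length K = n"
    using assms by (auto simp: bit_strings_def)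
  then have lt: "ket_index I < 2 ^ n" "ket_index K < 2 ^ n"
    using ket_index_less by metis+
  have "ket_index K = ket_index I \<longleftrightarrow> I = K" using len ket_index_inj by metis
  then have entry: "ket I $ ket_index K = of_bool (I = K)"
    using lt by (simp add: ket_eq_unit_vec len)
  have "ket I \<in> carrier_vec (2 ^ n)" by (simp add: ket_eq_unit_vec len)
  from block_vec_tensor_vec[OF this assms(3) lt(2)] show ?thesis
    using assms(3) by (auto simp: entry)
qed

lemma block_mat_tensor_mat:
  assumes "A \<in> carrier_mat m m" "B \<in> carrier_mat D D" "i < m" "j < m"
  shows "block_mat D (tensor_mat A B) i j = A $$ (i, j) \<cdot>\<^sub>m B"
  using assms by (intro eq_matI) (auto simp: block_mat_def tensor_mat_def block_index_less)

lemma block_mat_tensor_ketbra: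
  assumes "I \<in> bit_strings n" "J \<in> bit_strings n" "K \<in> bit_strings n" "L \<in> bit_strings n"
    and "B \<in> carrier_mat D D"
  shows "block_mat D (tensor_mat (ketbra (ket I) (ket J)) B) (ket_index K) (ket_index L) =
    (if I = K \<and> J = L then B else 0\<^sub>m D D)"
proof -
  have len: "length I = n" "length J = n" "length K = n" "length L = n"
    using assms by (auto simp: bit_strings_def)
  then have lt: "ket_index I < 2 ^ n" "ket_index J < 2 ^ n" "ket_index K < 2 ^ n" "ket_index L < 2 ^ n"
    using ket_index_less by metis+
  have inj: "ket_index K = ket_index I \<longleftrightarrow> I = K" "ket_index L = ket_index J \<longleftrightarrow> J = L"
    using len ket_index_inj by metis+
  have entry: "ketbra (ket I) (ket J) $$ (ket_index K, ket_index L) = of_bool (I = K \<and> J = L)"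
    using lt by (simp add: ketbra_def ket_eq_unit_vec len inj)
  have "ketbra (ket I) (ket J) \<in> carrier_mat (2 ^ n) (2 ^ n)"
    by (simp add: ket_eq_unit_vec len)
  from block_mat_tensor_mat[OF this assms(5) lt(3,4)] show ?thesis
    using assms(5) by (auto simp: entry)
qed

lemma tensor_mat_carrier:
  "A \<in> carrier_mat m n \<Longrightarrow> B \<in> carrier_mat p q \<Longrightarrow> tensor_mat A B \<in> carrier_mat (m * p) (n * q)"
  by (auto simp: tensor_mat_def)

lemma ket_carrier: "I \<in> bit_strings n \<Longrightarrow> ket I \<in> carrier_vec (2 ^ n)"
  by (simp add: ket_eq_unit_vec bit_strings_def)

text \<open>Each summand occupies a single block, and different pairs of strings occupy different
  blocks, so a block of the sum meets at most one summand.\<close>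

lemma ketbra_sum_carrier_block:
  fixes X :: "bool list \<Rightarrow> bool list \<Rightarrow> complex mat"
  assumes S: "S \<subseteq> bit_strings n"
    and X: "\<And>I J. I \<in> S \<Longrightarrow> J \<in> S \<Longrightarrow> X I J \<in> carrier_mat D D"
  defines "M \<equiv> finsum_mat (2 ^ n * D) (2 ^ n * D)
    (\<lambda>(I, J). tensor_mat (ketbra (ket I) (ket J)) (X I J)) (S \<times> S)"
  shows "M \<in> carrier_mat (2 ^ n * D) (2 ^ n * D)"
    and "K \<in> bit_strings n \<Longrightarrow> L \<in> bit_strings n \<Longrightarrow>
      block_mat D M (ket_index K) (ket_index L) = (if K \<in> S \<and> L \<in> S then X K L else 0\<^sub>m D D)"
proof -
  have fin: "finite S" using finite_subset[OF S] by simp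
  have carr: "tensor_mat (ketbra (ket I) (ket J)) (X I J) \<in> carrier_mat (2 ^ n * D) (2 ^ n * D)"
    if "I \<in> S" "J \<in> S" for I J
    using that S X by (intro tensor_mat_carrier ketbra_carrier ket_carrier) auto
  have M: "M \<in> carrier_mat (2 ^ n * D) (2 ^ n * D)"
    and Mi: "\<And>i j. i < 2 ^ n * D \<Longrightarrow> j < 2 ^ n * D \<Longrightarrow>
      M $$ (i, j) = (\<Sum>(I, J)\<in>S \<times> S. tensor_mat (ketbra (ket I) (ket J)) (X I J) $$ (i, j))"
    using finsum_mat_carrier_index[of "S \<times> S"
        "\<lambda>(I, J). tensor_mat (ketbra (ket I) (ket J)) (X I J)" "2 ^ n * D" "2 ^ n * D"] fin carr
    by (auto simp: M_def case_prod_unfold)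
  show "M \<in> carrier_mat (2 ^ n * D) (2 ^ n * D)" by (rule M)
  assume KL: "K \<in> bit_strings n" "L \<in> bit_strings n"
  show "block_mat D M (ket_index K) (ket_index L) = (if K \<in> S \<and> L \<in> S then X K L else 0\<^sub>m D D)"
  proof (rule eq_matI)
    fix a b
    assume "a < dim_row (if K \<in> S \<and> L \<in> S then X K L else 0\<^sub>m D D)"
      and "b < dim_col (if K \<in> S \<and> L \<in> S then X K L else 0\<^sub>m D D)"
    then have ab: "a < D" "b < D" using X by (auto split: if_splits)
    have KL': "ket_index K < 2 ^ n" "ket_index L < 2 ^ n"
      using KL ket_index_less[of K] ket_index_less[of L] by (auto simp: bit_strings_def)
    have "block_mat D M (ket_index K) (ket_index L) $$ (a, b)
      = (\<Sum>(I, J)\<in>S \<times> S. block_mat D (tensor_mat (ketbra (ket I) (ket J)) (X I J)) (ket_index K) (ket_index L) $$ (a, b))"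
      using ab KL' by (simp add: block_mat_def Mi block_index_less)
    also have "\<dots> = (\<Sum>(I, J)\<in>S \<times> S. if (I, J) = (K, L) then X K L $$ (a, b) else 0)"
      using S X ab KL by (intro sum.cong) (auto simp: block_mat_tensor_ketbra[of _ n] subset_iff)
    also have "\<dots> = (\<Sum>q\<in>S \<times> S. if q = (K, L) then X K L $$ (a, b) else 0)"
      by (intro sum.cong refl) (simp add: case_prod_unfold prod_eq_iff)
    also have "\<dots> = (if K \<in> S \<and> L \<in> S then X K L else 0\<^sub>m D D) $$ (a, b)"
      using fin ab by (auto simp: sum.delta)
    finally show "block_mat D M (ket_index K) (ket_index L) $$ (a, b)
      = (if K \<in> S \<and> L \<in> S then X K L else 0\<^sub>m D D) $$ (a, b)" .
  qed (use X in \<open>auto simp: block_mat_def\<close>)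
qed

text \<open>Only the summand with \<open>I = K\<close> is nonzero in this block. Hence the
  amplitudes of an outcome decomposition can be read off blockwise.\<close>

lemma block_vec_outcome_sum:
  assumes "\<And>I. I \<in> bit_strings n \<Longrightarrow> \<Phi> I \<in> carrier_vec k" "K \<in> bit_strings n"
  shows "block_vec k (ket_index K) (finsum_vec TYPE(complex) (2 ^ n * k)
      (\<lambda>I. c I \<cdot>\<^sub>v tensor_vec (ket I) (\<Phi> I)) (bit_strings n)) = c K \<cdot>\<^sub>v \<Phi> K"
proof (rule eq_vecI)
  fix a assume "a < dim_vec (c K \<cdot>\<^sub>v \<Phi> K)"
  then have a: "a < k" using assms(1)[OF assms(2)] by auto
  have carr: "tensor_vec (ket I) (\<Phi> I) \<in> carrier_vec (2 ^ n * k)" if "I \<in> bit_strings n" for I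
    using assms(1)[OF that] ket_carrier[OF that] by (auto simp: tensor_vec_def)
  have K: "ket_index K < 2 ^ n" using assms(2) ket_index_less by (auto simp: bit_strings_def)
  note lt = block_index_less[OF K a]
  have "block_vec k (ket_index K) (finsum_vec TYPE(complex) (2 ^ n * k)
      (\<lambda>I. c I \<cdot>\<^sub>v tensor_vec (ket I) (\<Phi> I)) (bit_strings n)) $ a
    = (\<Sum>I\<in>bit_strings n. (c I \<cdot>\<^sub>v tensor_vec (ket I) (\<Phi> I)) $ (ket_index K * k + a))"
    using a lt carr by (simp add: block_vec_def) (subst index_finsum_vec, auto)
  also have "\<dots> = (\<Sum>I\<in>bit_strings n. c I * block_vec k (ket_index K) (tensor_vec (ket I) (\<Phi> I)) $ a)"
    using a lt by (intro sum.cong) (auto simp: block_vec_def carrier_vecD[OF carr])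
  also have "\<dots> = (\<Sum>I\<in>bit_strings n. if I = K then c K * \<Phi> K $ a else 0)"
    using assms a by (intro sum.cong) (auto simp: block_vec_tensor_ket)
  finally show "block_vec k (ket_index K) (finsum_vec TYPE(complex) (2 ^ n * k)
      (\<lambda>I. c I \<cdot>\<^sub>v tensor_vec (ket I) (\<Phi> I)) (bit_strings n)) $ a = (c K \<cdot>\<^sub>v \<Phi> K) $ a"
    using assms a by (simp add: carrier_vecD[OF assms(1)[OF assms(2)]] sum.delta)
qed (simp add: block_vec_def carrier_vecD[OF assms(1)[OF assms(2)]])

section \<open>Outcome decompositions\<close>

text \<open>Cut the vector into blocks and normalise each of them; the probabilities are the squared
  lengths. Positivity of the dimension supplies a unit vector for the zero blocks.\<close>

lemma outcome_decomposition_exists: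
  assumes \<Psi>: "\<Psi> \<in> carrier_vec (2 ^ n * (D * e))" and pos: "D * e > 0"
  shows "\<exists>p \<Phi>. outcome_decomposition n D e \<Psi> p \<Phi>"
proof -
  define \<psi> where "\<psi> = (\<lambda>I. block_vec (D * e) (ket_index I) \<Psi>)"
  define p where "p = (\<lambda>I. Re (\<psi> I \<bullet>c \<psi> I))"
  \<comment> \<open>A zero block cannot be normalised and gets a fixed unit vector, which is
    harmless because its coefficient \<open>sqrt (p I)\<close> vanishes.\<close>
  define \<Phi> where "\<Phi> = (\<lambda>I. if \<psi> I = 0\<^sub>v (D * e) then unit_vec (D * e) 0
    else complex_of_real (1 / sqrt (p I)) \<cdot>\<^sub>v \<psi> I)"
  have \<psi>: "\<psi> I \<in> carrier_vec (D * e)" for I by (simp add: \<psi>_def)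
  have "0 \<le> \<psi> I \<bullet>c \<psi> I" for I by (rule conjugate_square_ge_0_vec)
  then have p: "complex_of_real (p I) = \<psi> I \<bullet>c \<psi> I" "0 \<le> p I" for I
    by (auto simp: p_def less_eq_complex_def complex_eq_iff)
  have p0: "p I = 0 \<longleftrightarrow> \<psi> I = 0\<^sub>v (D * e)" for I
    using conjugate_square_eq_0_vec[OF \<psi>[of I]] p(1)[of I] by auto
  have \<Phi>: "\<Phi> I \<in> carrier_vec (D * e)" for I using \<psi> by (simp add: \<Phi>_def)
  have unit: "\<Phi> I \<bullet>c \<Phi> I = 1" for I
  proof (cases "p I = 0")
    case True
    then show ?thesis using p0[of I] pos by (simp add: \<Phi>_def)
  next
    case False
    define c where "c = complex_of_real (1 / sqrt (p I))"
    have "\<Phi> I = c \<cdot>\<^sub>v \<psi> I" using False p0[of I] by (simp add: \<Phi>_def c_def)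
    then have "\<Phi> I \<bullet>c \<Phi> I = c * (cnj c * (\<psi> I \<bullet>c \<psi> I))"
      using \<psi>[of I] by (simp add: conjugate_smult_vec)
    also have "\<dots> = complex_of_real (1 / sqrt (p I) * (1 / sqrt (p I)) * p I)"
      unfolding c_def p(1)[symmetric]
      by (simp only: complex_cnj_complex_of_real of_real_mult mult.assoc)
    also have "1 / sqrt (p I) * (1 / sqrt (p I)) * p I = 1"
      using False p(2)[of I] by (simp add: field_simps)
    finally show ?thesis by simp
  qed
  have scaled: "complex_of_real (sqrt (p I)) \<cdot>\<^sub>v \<Phi> I = \<psi> I" for I
  proof (cases "p I = 0")
    case True
    then show ?thesis using p0[of I] \<Phi>[of I] by auto
  next
    case False
    then have "sqrt (p I) * (1 / sqrt (p I)) = 1" by simp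
    then have "complex_of_real (sqrt (p I)) * complex_of_real (1 / sqrt (p I)) = 1"
      by (metis of_real_mult of_real_1)
    moreover have "\<Phi> I = complex_of_real (1 / sqrt (p I)) \<cdot>\<^sub>v \<psi> I"
      using False p0[of I] by (simp add: \<Phi>_def)
    ultimately show ?thesis by (simp only: smult_smult_assoc one_smult_vec)
  qed
  have "\<Psi> = finsum_vec TYPE(complex) (2 ^ n * (D * e))
      (\<lambda>I. complex_of_real (sqrt (p I)) \<cdot>\<^sub>v tensor_vec (ket I) (\<Phi> I)) (bit_strings n)"
  proof (rule eq_vec_if_blocks_eq[OF \<Psi>])
    show "finsum_vec TYPE(complex) (2 ^ n * (D * e))
      (\<lambda>I. complex_of_real (sqrt (p I)) \<cdot>\<^sub>v tensor_vec (ket I) (\<Phi> I)) (bit_strings n)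
      \<in> carrier_vec (2 ^ n * (D * e))"
      using \<Phi> ket_carrier by (intro finsum_vec_closed) (fastforce simp: tensor_vec_def)
    fix i :: nat assume "i < 2 ^ n"
    then obtain K where K: "K \<in> bit_strings n" "ket_index K = i" by (rule ket_index_surj)
    show "block_vec (D * e) i \<Psi> = block_vec (D * e) i (finsum_vec TYPE(complex) (2 ^ n * (D * e))
      (\<lambda>I. complex_of_real (sqrt (p I)) \<cdot>\<^sub>v tensor_vec (ket I) (\<Phi> I)) (bit_strings n))"
      using block_vec_outcome_sum[of n \<Phi> "D * e" K] K \<Phi> scaled[of K] by (simp add: \<psi>_def)
  qed
  then have "outcome_decomposition n D e \<Psi> p \<Phi>"
    using p(2) \<Phi> unit unfolding outcome_decomposition_def by blast
  then show ?thesis by blast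
qed

text \<open>The bridge used in both directions: it expresses every block of the state through the
  conditional vectors of an arbitrary purification.\<close>

lemma purification_outcome_block_mat:
  assumes "purification (2 ^ n * D) e \<rho> \<Psi>" "outcome_decomposition n D e \<Psi> p \<Phi>"
    and "I \<in> bit_strings n" "J \<in> bit_strings n"
  shows "block_mat D \<rho> (ket_index I) (ket_index J) =
    complex_of_real (sqrt (p I) * sqrt (p J)) \<cdot>\<^sub>m
      (mat_of_vec D e (\<Phi> I) * mat_adjoint (mat_of_vec D e (\<Phi> J)))"
proof -
  have \<Phi>: "\<Phi> I \<in> carrier_vec (D * e)" if "I \<in> bit_strings n" for I
    using assms(2) that by (simp add: outcome_decomposition_def)
  have bl: "block_vec (D * e) (ket_index I) \<Psi> = complex_of_real (sqrt (p I)) \<cdot>\<^sub>v \<Phi> I"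
    if "I \<in> bit_strings n" for I
    using assms(2) block_vec_outcome_sum[of n \<Phi> "D * e" I] \<Phi> that
    by (simp add: outcome_decomposition_def)
  have "ket_index I < 2 ^ n" "ket_index J < 2 ^ n"
    using assms(3,4) ket_index_less[of I] ket_index_less[of J] by (auto simp: bit_strings_def)
  from purification_block_mat[OF assms(1) this] show ?thesis
    by (simp add: bl assms(3,4) \<Phi> mat_of_vec_smult mat_adjoint_smult smult_mult_smult_mat[of _ D e _ D])
qed

section \<open>The characterisation\<close>

text \<open>In physical terms, a unitary acting on the players' and dealer's auxiliary systems
  leaves Eve's state unchanged.\<close>

lemma unitary_gram_mult:
  assumes U: "unitary_op D U" and G: "G \<in> carrier_mat D e"
  shows "mat_adjoint (U * G) * (U * G) = mat_adjoint G * G"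
proof -
  note Uc = unitary_op_carrier[OF U]
  have "mat_adjoint (U * G) * (U * G) = mat_adjoint G * mat_adjoint U * (U * G)"
    using mat_adjoint_mult[OF Uc G] by simp
  also have "\<dots> = mat_adjoint G * (mat_adjoint U * (U * G))"
    using Uc G by (intro assoc_mult_mat) auto
  also have "mat_adjoint U * (U * G) = mat_adjoint U * U * G"
    using Uc G by (intro assoc_mult_mat[symmetric]) auto
  finally show ?thesis using U G by (simp add: unitary_op_def)
qed

lemma mult_adjoint_conj:
  fixes U V G H :: "complex mat"
  assumes "U \<in> carrier_mat D D" "V \<in> carrier_mat D D" "G \<in> carrier_mat D e" "H \<in> carrier_mat D e"
  shows "(U * G) * mat_adjoint (V * H) = U * (G * mat_adjoint H) * mat_adjoint V"
proof -
  have "(U * G) * mat_adjoint (V * H) = (U * G) * (mat_adjoint H * mat_adjoint V)"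
    using mat_adjoint_mult[OF assms(2,4)] by simp
  also have "\<dots> = (U * G) * mat_adjoint H * mat_adjoint V"
    using assms by (intro assoc_mult_mat[symmetric]) auto
  also have "(U * G) * mat_adjoint H = U * (G * mat_adjoint H)"
    using assms by (intro assoc_mult_mat) auto
  finally show ?thesis .
qed

lemma unitary_cancel:
  assumes U: "unitary_op D U" and V: "unitary_op D V" and \<sigma>: "\<sigma> \<in> carrier_mat D D"
  shows "mat_adjoint U * (U * \<sigma> * mat_adjoint V) * V = \<sigma>"
proof -
  note Uc = unitary_op_carrier[OF U] and Vc = unitary_op_carrier[OF V]
  have "mat_adjoint U * (U * \<sigma> * mat_adjoint V) = mat_adjoint U * (U * (\<sigma> * mat_adjoint V))"
    using Uc Vc \<sigma> by (subst assoc_mult_mat[of U D D \<sigma> D]) auto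
  also have "\<dots> = mat_adjoint U * U * (\<sigma> * mat_adjoint V)"
    using Uc Vc \<sigma> by (intro assoc_mult_mat[symmetric]) auto
  also have "\<dots> = \<sigma> * mat_adjoint V" using U Vc \<sigma> by (simp add: unitary_op_def)
  also have "\<dots> * V = \<sigma> * (mat_adjoint V * V)" using Vc \<sigma> by (intro assoc_mult_mat) auto
  finally show ?thesis using V \<sigma> by (simp add: unitary_op_def)
qed

text \<open>Moving \<open>F\<close> to the other side turns the quadratic form into the squared
  length of \<open>mat_adjoint F *\<^sub>v v\<close>.\<close>

lemma density_operator_times_adjoint:
  assumes F: "F \<in> carrier_mat D e" and tr: "trace_mat (F * mat_adjoint F) = 1"
  shows "density_operator D (F * mat_adjoint F)"
proof -
  have "0 \<le> (F * mat_adjoint F *\<^sub>v v) \<bullet>c v" if v: "v \<in> carrier_vec D" for v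
  proof -
    have "(F * mat_adjoint F *\<^sub>v v) \<bullet>c v = (F *\<^sub>v (mat_adjoint F *\<^sub>v v)) \<bullet>c v"
      using F v assoc_mult_mat_vec[of F D e "mat_adjoint F" D v] by simp
    also have "\<dots> = (mat_adjoint F *\<^sub>v v) \<bullet>c (mat_adjoint F *\<^sub>v v)"
      using F v by (intro mult_mat_vec_cscalar_prod[of _ D e]) auto
    finally show ?thesis using conjugate_square_ge_0_vec by metis
  qed
  then show ?thesis using F tr by (simp add: density_operator_def)
qed

lemma smult_mat_cancel:
  fixes A B :: "complex mat"
  assumes "c \<cdot>\<^sub>m A = c \<cdot>\<^sub>m B" "c \<noteq> 0"
  shows "A = B"
proof -
  have *: "C = (1 / c) \<cdot>\<^sub>m (c \<cdot>\<^sub>m C)" for C :: "complex mat"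
    using assms(2) by (intro eq_matI) auto
  from *[of A] have "A = (1 / c) \<cdot>\<^sub>m (c \<cdot>\<^sub>m B)" unfolding assms(1) .
  also have "\<dots> = B" by (rule *[symmetric])
  finally show ?thesis .
qed

lemma block_mat_smult:
  assumes "M \<in> carrier_mat (m * D) (m * D)" "i < m" "j < m"
  shows "block_mat D (c \<cdot>\<^sub>m M) i j = c \<cdot>\<^sub>m block_mat D M i j"
  using assms by (intro eq_matI) (auto simp: block_mat_def block_index_less)

lemma even_strings_subset: "even_strings n \<subseteq> bit_strings n"
  by (auto simp: even_strings_def)

lemma replicate_False_even: "replicate n False \<in> even_strings n"
  by (auto simp: even_strings_def bit_strings_def count_list_0_iff)

lemma aux_dim_pos:
  assumes "\<And>m. m \<in> {1..n} \<Longrightarrow> d m \<ge> 1"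
  shows "aux_dim n d > 0"
  unfolding aux_dim_def
proof (rule prod_pos)
  show "0 < d m" if "m \<in> {1..n}" for m using assms[OF that] by simp
qed

section \<open>From the secret sharing conditions to the twisted form\<close>

text \<open>The conditions speak about all purifications, so a concrete one with an outcome
  decomposition is produced first. The unitaries compare each even string with the all-zero
  string.\<close>

lemma psss_state_imp_form:
  assumes D: "D = aux_dim n d" "D > 0" and \<rho>: "density_operator (2 ^ n * D) \<rho>" and psss: "psss_state n d \<rho>"
  shows "\<exists>(\<sigma> :: complex mat) (U :: bool list \<Rightarrow> complex mat).
    density_operator D \<sigma> \<and> (\<forall>I \<in> even_strings n. unitary_op D (U I)) \<and>
    \<rho> = (1 / 2 ^ (n - 1)) \<cdot>\<^sub>m finsum_mat (2 ^ n * D) (2 ^ n * D)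
      (\<lambda>(I, J). tensor_mat (ketbra (ket I) (ket J)) (U I * \<sigma> * mat_adjoint (U J)))
      (even_strings n \<times> even_strings n)"
proof -
  define e where "e = 2 ^ n * D"
  obtain \<Psi> where \<Psi>: "purification (2 ^ n * D) e \<rho> \<Psi>"
    using density_operator_purification[OF \<rho>] by (auto simp: e_def)
  then have "\<Psi> \<in> carrier_vec (2 ^ n * (D * e))" by (simp add: purification_def mult.assoc)
  then obtain p \<Phi> where out: "outcome_decomposition n D e \<Psi> p \<Phi>"
    using outcome_decomposition_exists D(2) by (fastforce simp: e_def)
  have p_even: "\<And>I. I \<in> even_strings n \<Longrightarrow> p I = 1 / 2 ^ (n - 1)"
    and p_odd: "\<And>I. I \<in> bit_strings n - even_strings n \<Longrightarrow> p I = 0"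
    and eve: "\<And>I J. I \<in> even_strings n \<Longrightarrow> J \<in> even_strings n \<Longrightarrow> eve_state D e (\<Phi> I) = eve_state D e (\<Phi> J)"
    using psss \<Psi> out unfolding psss_state_def D(1) by blast+
  have \<Phi>: "\<Phi> I \<in> carrier_vec (D * e)" "\<Phi> I \<bullet>c \<Phi> I = 1" if "I \<in> bit_strings n" for I
    using out that by (auto simp: outcome_decomposition_def)
  define F where "F = (\<lambda>I. mat_of_vec D e (\<Phi> I))"
  have F: "F I \<in> carrier_mat D e" for I by (simp add: F_def)
  define Z where "Z = replicate n False"
  have Z: "Z \<in> even_strings n" "Z \<in> bit_strings n"
    using replicate_False_even even_strings_subset by (auto simp: Z_def)
  have "\<exists>U. unitary_op D U \<and> F I = U * F Z" if I: "I \<in> even_strings n" for I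
  proof (rule unitary_if_gram_eq[OF F F])
    have "I \<in> bit_strings n" using I even_strings_subset by blast
    then show "mat_adjoint (F I) * F I = mat_adjoint (F Z) * F Z"
      using eve[OF I Z(1)] Z(2) \<Phi>(1) by (simp add: eve_state_eq_transpose F_def)
  qed
  then obtain U where U: "\<And>I. I \<in> even_strings n \<Longrightarrow> unitary_op D (U I)"
    and FU: "\<And>I. I \<in> even_strings n \<Longrightarrow> F I = U I * F Z"
    by metis
  \<comment> \<open>The state of the auxiliary systems after the reference outcome \<open>Z\<close>;
    it has trace one because \<open>\<Phi> Z\<close> is a unit vector.\<close>
  define \<sigma> where "\<sigma> = F Z * mat_adjoint (F Z)"
  have \<sigma>: "density_operator D \<sigma>"
    unfolding \<sigma>_def using F trace_mat_of_vec[OF \<Phi>(1)[OF Z(2)]] \<Phi>(2)[OF Z(2)]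
    by (intro density_operator_times_adjoint) (auto simp: F_def)
  have \<sigma>c: "\<sigma> \<in> carrier_mat D D" using \<sigma> by (simp add: density_operator_def)
  let ?X = "\<lambda>I J. U I * \<sigma> * mat_adjoint (U J)"
  let ?M = "finsum_mat (2 ^ n * D) (2 ^ n * D)
      (\<lambda>(I, J). tensor_mat (ketbra (ket I) (ket J)) (?X I J)) (even_strings n \<times> even_strings n)"
  have X: "?X I J \<in> carrier_mat D D" if "I \<in> even_strings n" "J \<in> even_strings n" for I J
    using unitary_op_carrier[OF U[OF that(1)]] unitary_op_carrier[OF U[OF that(2)]] \<sigma>c
    by (intro mult_carrier_mat[of _ D D]) auto
  have M: "?M \<in> carrier_mat (2 ^ n * D) (2 ^ n * D)"
    by (intro ketbra_sum_carrier_block(1) even_strings_subset X)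
  have "\<rho> = (1 / 2 ^ (n - 1)) \<cdot>\<^sub>m ?M"
  proof (rule eq_mat_if_blocks_eq)
    show "\<rho> \<in> carrier_mat (2 ^ n * D) (2 ^ n * D)" using \<rho> by (simp add: density_operator_def)
    show "(1 / 2 ^ (n - 1)) \<cdot>\<^sub>m ?M \<in> carrier_mat (2 ^ n * D) (2 ^ n * D)" using M by simp
    fix i j :: nat assume ij: "i < 2 ^ n" "j < 2 ^ n"
    obtain I where I: "I \<in> bit_strings n" "ket_index I = i" using ket_index_surj[OF ij(1)] .
    obtain J where J: "J \<in> bit_strings n" "ket_index J = j" using ket_index_surj[OF ij(2)] .
    have "block_mat D ((1 / 2 ^ (n - 1)) \<cdot>\<^sub>m ?M) i j = (1 / 2 ^ (n - 1)) \<cdot>\<^sub>m block_mat D ?M i j"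
      using M ij by (rule block_mat_smult)
    also have "block_mat D ?M i j = (if I \<in> even_strings n \<and> J \<in> even_strings n then ?X I J else 0\<^sub>m D D)"
      using ketbra_sum_carrier_block(2)[OF even_strings_subset X I(1) J(1)] I(2) J(2) by simp
    finally have R: "block_mat D ((1 / 2 ^ (n - 1)) \<cdot>\<^sub>m ?M) i j =
      (1 / 2 ^ (n - 1)) \<cdot>\<^sub>m (if I \<in> even_strings n \<and> J \<in> even_strings n then ?X I J else 0\<^sub>m D D)" .
    have L: "block_mat D \<rho> i j = complex_of_real (sqrt (p I) * sqrt (p J)) \<cdot>\<^sub>m (F I * mat_adjoint (F J))"
      using purification_outcome_block_mat[OF \<Psi> out I(1) J(1)] I(2) J(2) by (simp add: F_def)
    show "block_mat D \<rho> i j = block_mat D ((1 / 2 ^ (n - 1)) \<cdot>\<^sub>m ?M) i j"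
    proof (cases "I \<in> even_strings n \<and> J \<in> even_strings n")
      case True
      then have IJ: "I \<in> even_strings n" "J \<in> even_strings n" by auto
      have "F I * mat_adjoint (F J) = ?X I J"
        unfolding FU[OF IJ(1)] FU[OF IJ(2)] \<sigma>_def
        by (rule mult_adjoint_conj[OF unitary_op_carrier[OF U[OF IJ(1)]] unitary_op_carrier[OF U[OF IJ(2)]] F F])
      moreover have "sqrt (p I) * sqrt (p J) = 1 / 2 ^ (n - 1)"
        unfolding p_even[OF IJ(1)] p_even[OF IJ(2)] by (rule real_sqrt_mult_self[THEN trans]) simp
      ultimately show ?thesis unfolding L R using True by simp
    next
      case False
      \<comment> \<open>At least one of the two strings is odd and has probability zero, so the
        block vanishes on both sides.\<close>
      then have "sqrt (p I) * sqrt (p J) = 0" using p_odd I(1) J(1) by auto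
      then show ?thesis unfolding L R using False F[of I] F[of J] by (intro eq_matI) auto
    qed
  qed
  then show ?thesis using \<sigma> U by blast
qed

section \<open>From the twisted form to the secret sharing conditions\<close>

text \<open>For an arbitrary purification, the traces of the diagonal blocks give the probabilities,
  and the blocks of all pairs of even strings together force Eve's states to agree.\<close>

lemma form_imp_psss_state:
  assumes D: "D = aux_dim n d"
    and \<sigma>: "density_operator D \<sigma>" and U: "\<And>I. I \<in> even_strings n \<Longrightarrow> unitary_op D (U I)"
    and \<rho>: "\<rho> = (1 / 2 ^ (n - 1)) \<cdot>\<^sub>m finsum_mat (2 ^ n * D) (2 ^ n * D)
      (\<lambda>(I, J). tensor_mat (ketbra (ket I) (ket J)) (U I * \<sigma> * mat_adjoint (U J)))
      (even_strings n \<times> even_strings n)"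
  shows "psss_state n d \<rho>"
  unfolding psss_state_def D[symmetric]
proof (intro allI impI)
  fix e \<Psi> p \<Phi>
  assume \<Psi>: "purification (2 ^ n * D) e \<rho> \<Psi>" and out: "outcome_decomposition n D e \<Psi> p \<Phi>"
  have \<sigma>c: "\<sigma> \<in> carrier_mat D D" and tr\<sigma>: "trace_mat \<sigma> = 1"
    using \<sigma> by (auto simp: density_operator_def)
  let ?X = "\<lambda>I J. U I * \<sigma> * mat_adjoint (U J)"
  let ?M = "finsum_mat (2 ^ n * D) (2 ^ n * D)
      (\<lambda>(I, J). tensor_mat (ketbra (ket I) (ket J)) (?X I J)) (even_strings n \<times> even_strings n)"
  have X: "?X I J \<in> carrier_mat D D" if "I \<in> even_strings n" "J \<in> even_strings n" for I J
    using unitary_op_carrier[OF U[OF that(1)]] unitary_op_carrier[OF U[OF that(2)]] \<sigma>c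
    by (intro mult_carrier_mat[of _ D D]) auto
  have M: "?M \<in> carrier_mat (2 ^ n * D) (2 ^ n * D)"
    by (intro ketbra_sum_carrier_block(1) even_strings_subset X)
  have \<Phi>: "\<Phi> I \<in> carrier_vec (D * e)" "\<Phi> I \<bullet>c \<Phi> I = 1" and p0: "0 \<le> p I" if "I \<in> bit_strings n" for I
    using out that by (auto simp: outcome_decomposition_def)
  define F where "F = (\<lambda>I. mat_of_vec D e (\<Phi> I))"
  have F: "F I \<in> carrier_mat D e" for I by (simp add: F_def)
  \<comment> \<open>Two descriptions of one block of \<open>\<rho>\<close>, by the purification and
    by the given sum. Both conditions are extracted from this identity.\<close>
  have block: "complex_of_real (sqrt (p I) * sqrt (p J)) \<cdot>\<^sub>m (F I * mat_adjoint (F J)) =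
      (1 / 2 ^ (n - 1)) \<cdot>\<^sub>m (if I \<in> even_strings n \<and> J \<in> even_strings n then ?X I J else 0\<^sub>m D D)"
    if IJ: "I \<in> bit_strings n" "J \<in> bit_strings n" for I J
  proof -
    have "ket_index I < 2 ^ n" "ket_index J < 2 ^ n"
      using IJ ket_index_less[of I] ket_index_less[of J] by (auto simp: bit_strings_def)
    then have "block_mat D \<rho> (ket_index I) (ket_index J) =
        (1 / 2 ^ (n - 1)) \<cdot>\<^sub>m block_mat D ?M (ket_index I) (ket_index J)"
      unfolding \<rho> using M by (intro block_mat_smult)
    also have "block_mat D ?M (ket_index I) (ket_index J) =
        (if I \<in> even_strings n \<and> J \<in> even_strings n then ?X I J else 0\<^sub>m D D)"
      by (rule ketbra_sum_carrier_block(2)[OF even_strings_subset X IJ])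
    finally show ?thesis
      using purification_outcome_block_mat[OF \<Psi> out IJ] by (simp add: F_def)
  qed
  have trp: "complex_of_real (p I) =
      (1 / 2 ^ (n - 1)) * trace_mat (if I \<in> even_strings n then ?X I I else 0\<^sub>m D D)"
    if I: "I \<in> bit_strings n" for I
  proof -
    \<comment> \<open>The trace on the right is the squared length of the unit vector
      \<open>\<Phi> I\<close>.\<close>
    have "complex_of_real (p I) = complex_of_real (sqrt (p I) * sqrt (p I)) * trace_mat (F I * mat_adjoint (F I))"
      using trace_mat_of_vec[OF \<Phi>(1)[OF I]] \<Phi>(2)[OF I] p0[OF I] by (simp add: F_def)
    also have "\<dots> = trace_mat (complex_of_real (sqrt (p I) * sqrt (p I)) \<cdot>\<^sub>m (F I * mat_adjoint (F I)))"
      using F[of I] by (intro trace_mat_smult[symmetric, of _ D]) simp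
    also have "\<dots> = trace_mat ((1 / 2 ^ (n - 1)) \<cdot>\<^sub>m (if I \<in> even_strings n then ?X I I else 0\<^sub>m D D))"
      using block[OF I I] by simp
    also have "\<dots> = (1 / 2 ^ (n - 1)) * trace_mat (if I \<in> even_strings n then ?X I I else 0\<^sub>m D D)"
      using X[of I I] by (intro trace_mat_smult[of _ D]) auto
    finally show ?thesis .
  qed
  have p_even: "p I = 1 / 2 ^ (n - 1)" if I: "I \<in> even_strings n" for I
  proof -
    have "I \<in> bit_strings n" using I even_strings_subset by blast
    then have "complex_of_real (p I) = complex_of_real (1 / 2 ^ (n - 1))"
      using trp[of I] I trace_mat_unitary_conj[OF U[OF I] \<sigma>c] tr\<sigma> by simp
    then show ?thesis by (simp only: of_real_eq_iff)
  qed
  have p_odd: "p I = 0" if "I \<in> bit_strings n - even_strings n" for I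
    using trp[of I] that by simp
  \<comment> \<open>Undoing \<open>U I\<close> removes the dependence on the strings from all
    products of pairs, off-diagonal ones included.\<close>
  define G where "G = (\<lambda>I. mat_adjoint (U I) * F I)"
  have G: "G I \<in> carrier_mat D e" if "I \<in> even_strings n" for I
    using unitary_op_carrier[OF U[OF that]] F by (auto simp: G_def intro!: mult_carrier_mat[of _ D D])
  have GG: "G I * mat_adjoint (G J) = \<sigma>" if IJ: "I \<in> even_strings n" "J \<in> even_strings n" for I J
  proof -
    note Uc = unitary_op_carrier[OF U[OF IJ(1)]] unitary_op_carrier[OF U[OF IJ(2)]]
    have "I \<in> bit_strings n" "J \<in> bit_strings n" using IJ even_strings_subset by auto
    from block[OF this] have eq: "complex_of_real (sqrt (p I) * sqrt (p J)) \<cdot>\<^sub>m (F I * mat_adjoint (F J)) =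
        (1 / 2 ^ (n - 1)) \<cdot>\<^sub>m ?X I J" using IJ by simp
    have "sqrt (p I) * sqrt (p J) = 1 / 2 ^ (n - 1)"
      unfolding p_even[OF IJ(1)] p_even[OF IJ(2)] by (rule real_sqrt_mult_self[THEN trans]) simp
    with eq have eq2: "(1 / 2 ^ (n - 1)) \<cdot>\<^sub>m (F I * mat_adjoint (F J)) = (1 / 2 ^ (n - 1)) \<cdot>\<^sub>m ?X I J"
      by simp
    have "F I * mat_adjoint (F J) = ?X I J"
      by (rule smult_mat_cancel[OF eq2]) auto
    \<comment> \<open>The conjugation rule is applied to the adjoints of the unitaries, whence the
      double adjoint.\<close>
    then have "G I * mat_adjoint (G J) = mat_adjoint (U I) * ?X I J * mat_adjoint (mat_adjoint (U J))"
      unfolding G_def using Uc mult_adjoint_conj[of "mat_adjoint (U I)" D "mat_adjoint (U J)" "F I" e "F J"] F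
      by simp
    then show ?thesis using unitary_cancel[OF U[OF IJ(1)] U[OF IJ(2)] \<sigma>c] by simp
  qed
  have eve: "eve_state D e (\<Phi> I) = eve_state D e (\<Phi> J)" if IJ: "I \<in> even_strings n" "J \<in> even_strings n" for I J
  proof -
    have "G I = G J"
      by (rule mat_eq_if_gram_eq[OF G[OF IJ(1)] G[OF IJ(2)]]) (use GG IJ in auto)
    have gram: "mat_adjoint (G K) * G K = mat_adjoint (F K) * F K" if "K \<in> even_strings n" for K
      unfolding G_def by (rule unitary_gram_mult[OF unitary_op_adjoint[OF U[OF that]] F])
    have "mat_adjoint (F I) * F I = mat_adjoint (F J) * F J"
      using gram[OF IJ(1)] gram[OF IJ(2)] \<open>G I = G J\<close> by simp
    moreover have "I \<in> bit_strings n" "J \<in> bit_strings n" using IJ even_strings_subset by auto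
    ultimately show ?thesis using \<Phi>(1) by (simp add: eve_state_eq_transpose F_def)
  qed
  show "(\<forall>I \<in> even_strings n. p I = 1 / 2 ^ (n - 1)) \<and>
        (\<forall>I \<in> bit_strings n - even_strings n. p I = 0) \<and>
        (\<forall>I \<in> even_strings n. \<forall>J \<in> even_strings n. eve_state D e (\<Phi> I) = eve_state D e (\<Phi> J))"
    using p_even p_odd eve by blast
qed

theorem theorem4:
  fixes n :: nat and d :: "nat \<Rightarrow> nat" and \<rho> :: "complex mat"
  assumes "n \<ge> 3"
    and "\<And>m. m \<in> {1..n} \<Longrightarrow> d m \<ge> 1"
    and "density_operator (2 ^ n * aux_dim n d) \<rho>"
  shows "psss_state n d \<rho> \<longleftrightarrow>
    (\<exists>(\<sigma> :: complex mat) (U :: bool list \<Rightarrow> complex mat).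
       density_operator (aux_dim n d) \<sigma> \<and>
       (\<forall>I \<in> even_strings n. unitary_op (aux_dim n d) (U I)) \<and>
       \<rho> = (1 / 2 ^ (n - 1)) \<cdot>\<^sub>m
         finsum_mat (2 ^ n * aux_dim n d) (2 ^ n * aux_dim n d)
           (\<lambda>(I, J). tensor_mat (ketbra (ket I) (ket J)) (U I * \<sigma> * mat_adjoint (U J)))
           (even_strings n \<times> even_strings n))"
    (is "_ \<longleftrightarrow> ?form")
proof
  assume "psss_state n d \<rho>"
  then show ?form
    \<comment> \<open>Local dimensions of at least one make \<open>aux_dim n d\<close> positive, as
      the choice of unit vectors for null outcomes requires.\<close>
    using psss_state_imp_form[OF refl aux_dim_pos[OF assms(2)] assms(3)] by simp
next
  assume ?form
  then show "psss_state n d \<rho>"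
    using form_imp_psss_state[OF refl] by blast
qed

end
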